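(* For every 3-periodic of $\mathcal{E}$, the focus-inversive triangle is a 3-periodic billiard trajectory of its $X_9^\dagger$-centered circumellipse $\mathcal{C}^\dagger$, i.e. at each vertex of the focus-inversive triangle the normal to $\mathcal{C}^\dagger$ bisects the angle formed by the two sides meeting there. Since the semi-axes of $\mathcal{C}^\dagger$ do not depend on the 3-periodic, in a coordinate system centered at $X_9^\dagger$ and aligned with the axes of $\mathcal{C}^\dagger$ the focus-inversive triangles form a family of 3-periodic billiard trajectories of one fixed ellipse.
   Context: Let $a>b>0$ and let $\mathcal{E}$ be the ellipse $x^2/a^2+y^2/b^2=1$ (the elliptic billiard). Set $c=\sqrt{a^2-b^2}$, and let the foci be $f_1=(-c,0)$, $f_2=(c,0)$. A 3-periodic of an ellipse is a triangle with vertices on the ellipse such that at each vertex the normal to the ellipse bisects the angle formed by the two sides meeting at that vertex; for $\mathcal{E}$ these form a one-parameter family (there is one through every point of $\mathcal{E}$). Fix $\rho>0$. The focus-inversive triangle of a 3-periodic $P_1P_2P_3$ of $\mathcal{E}$ is the triangle with vertices $P_i^\dagger=f_1+(\rho/d_{1,i})^2(P_i-f_1)$, where $d_{1,i}=|P_i-f_1|$. The Mittenpunkt $X_9^\dagger$ is the point of concurrence of the lines joining each excenter of the focus-inversive triangle to the midpoint of the corresponding side, and $\mathcal{C}^\dagger$ denotes the unique circumellipse of the focus-inversive triangle centered at $X_9^\dagger$. Its semi-axes are invariant over the family (with explicit values depending only on $a,b,\rho$). *)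

theory Defs
  imports Complex_Main
begin

definition ell_pt :: "complex \<Rightarrow> real \<Rightarrow> real \<Rightarrow> real \<Rightarrow> complex \<Rightarrow> bool" where
  "ell_pt c al be th p \<longleftrightarrow>
     (let w = (p - c) * cis (- th) in (Re w)\<^sup>2 / al\<^sup>2 + (Im w)\<^sup>2 / be\<^sup>2 = 1)"

text \<open>A normal vector to that ellipse at p (half the gradient of its defining function).\<close>
definition ell_normal :: "complex \<Rightarrow> real \<Rightarrow> real \<Rightarrow> real \<Rightarrow> complex \<Rightarrow> complex" where
  "ell_normal c al be th p =
     (let w = (p - c) * cis (- th) in Complex (Re w / al\<^sup>2) (Im w / be\<^sup>2) * cis th)"

text \<open>Two vectors are parallel (the cross product vanishes).\<close>
definition parallel :: "complex \<Rightarrow> complex \<Rightarrow> bool" where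
  "parallel u v \<longleftrightarrow> Im (cnj u * v) = 0"

definition bisects :: "complex \<Rightarrow> complex \<Rightarrow> complex \<Rightarrow> complex \<Rightarrow> bool" where
  "bisects n P Q R \<longleftrightarrow>
     parallel n ((Q - P) / complex_of_real (cmod (Q - P)) + (R - P) / complex_of_real (cmod (R - P)))"

definition periodic3 :: "complex \<Rightarrow> real \<Rightarrow> real \<Rightarrow> real \<Rightarrow> complex \<Rightarrow> complex \<Rightarrow> complex \<Rightarrow> bool" where
  "periodic3 c al be th P1 P2 P3 \<longleftrightarrow>
     \<not> parallel (P2 - P1) (P3 - P1) \<and>
     ell_pt c al be th P1 \<and> ell_pt c al be th P2 \<and> ell_pt c al be th P3 \<and>
     bisects (ell_normal c al be th P1) P1 P2 P3 \<and>
     bisects (ell_normal c al be th P2) P2 P3 P1 \<and>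
     bisects (ell_normal c al be th P3) P3 P1 P2"

text \<open>Excenter opposite vertex A of triangle ABC (barycentrics (-a : b : c)).\<close>
definition excenter :: "complex \<Rightarrow> complex \<Rightarrow> complex \<Rightarrow> complex" where
  "excenter A B C =
     (let la = cmod (B - C); lb = cmod (C - A); lc = cmod (A - B) in
        (- complex_of_real la * A + complex_of_real lb * B + complex_of_real lc * C)
          / complex_of_real (- la + lb + lc))"

definition on_line :: "complex \<Rightarrow> complex \<Rightarrow> complex \<Rightarrow> bool" where
  "on_line E M X \<longleftrightarrow> parallel (M - E) (X - E)"

definition mittenpunkt :: "complex \<Rightarrow> complex \<Rightarrow> complex \<Rightarrow> complex" where
  "mittenpunkt A B C =
     (THE X. on_line (excenter A B C) ((B + C) / 2) X \<and>
             on_line (excenter B C A) ((C + A) / 2) X \<and>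
             on_line (excenter C A B) ((A + B) / 2) X)"

definition focus_inv :: "real \<Rightarrow> complex \<Rightarrow> complex \<Rightarrow> complex" where
  "focus_inv rho f1 P = f1 + complex_of_real ((rho / cmod (P - f1))\<^sup>2) * (P - f1)"

end

theory Submission
  imports Defs
begin

text \<open>
  Every nondegenerate triangle is a billiard trajectory of its Mittenpunkt-centred circumellipse,
  because the tangents of that ellipse at the vertices are the external angle bisectors.  With
  sides x, y, z, perimeter L and S = (2 (xy + yz + zx) - (x^2 + y^2 + z^2)) / (xyz), the semi-axes
  are determined by L and S alone.  So it suffices that L and S are constant on the family of
  focus-inversive triangles, and that LS > 8, which excludes degeneracy.

  Write a point of the billiard as (a Re u, b Im u) with |u| = 1.  The reflection law says that all
  three sides satisfy |u - v|^2 = 2 J |P - Q| with Joachimsthal's constant J.  Squaring gives a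
  symmetric biquadratic correspondence between u and v, which forces
  uv + vw + wu = -h and u + v + w = -h uvw for h = J^2 c^2, where h is a root of a quadratic
  with coefficients in a and b.  The focal distance is a + c Re u, so the sides of the
  focus-inversive triangle are rational in u, v, w, and L and S come out as functions of h
  by symmetric-function identities.
\<close>

section \<open>Bisectors and ellipses\<close>

lemma parallel_coords: "parallel z w \<longleftrightarrow> Re z * Im w - Im z * Re w = 0"
  by (simp add: parallel_def)

text \<open>The sum and the difference of two independent unit vectors are nonzero and orthogonal.
  In the plane a vector \<open>(k, l)\<close> is therefore parallel to the sum exactly when it is
  orthogonal to the difference. Each pair of identities below writes this in coordinates, and at
  least one coordinate factor is nonzero.\<close>

lemma cross_dot_unit_sum:
  fixes k l p q r s :: real
  assumes "p\<^sup>2 + q\<^sup>2 = 1" and "r\<^sup>2 + s\<^sup>2 = 1" and "p * s - q * r \<noteq> 0"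
  shows "k * (q + s) - l * (p + r) = 0 \<longleftrightarrow> k * p + l * q = k * r + l * s"
proof
  assume 0: "k * (q + s) - l * (p + r) = 0"
  have "(p + r) * (k * p + l * q - (k * r + l * s)) = - (q - s) * (k * (q + s) - l * (p + r))"
    and "(q + s) * (k * p + l * q - (k * r + l * s)) = (p - r) * (k * (q + s) - l * (p + r))"
    using assms(1,2) by algebra+
  moreover have "p + r \<noteq> 0 \<or> q + s \<noteq> 0"
  proof (rule ccontr)
    assume "\<not> ?thesis"
    then have "r = - p" "s = - q" by linarith+
    then show False using assms(3) by simp
  qed
  ultimately show "k * p + l * q = k * r + l * s" using 0 by auto
next
  assume 0: "k * p + l * q = k * r + l * s"
  have "(p - r) * (k * (q + s) - l * (p + r)) = (q + s) * (k * p + l * q - (k * r + l * s))"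
    and "(q - s) * (k * (q + s) - l * (p + r)) = - (p + r) * (k * p + l * q - (k * r + l * s))"
    using assms(1,2) by algebra+
  moreover have "p - r \<noteq> 0 \<or> q - s \<noteq> 0"
    using assms(3) by auto
  ultimately show "k * (q + s) - l * (p + r) = 0" using 0 by auto
qed

text \<open>Replaces the bisector condition by equality of the normal components of the two unit
  chords, a form that the quadratic form of the ellipse can evaluate.\<close>

lemma bisects_iff:
  assumes "\<not> parallel (Q - P) (R - P)"
  shows "bisects n P Q R \<longleftrightarrow>
    Re (cnj n * (Q - P)) / cmod (Q - P) = Re (cnj n * (R - P)) / cmod (R - P)"
proof -
  define z w where "z = Q - P" and "w = R - P"
  have nz: "z \<noteq> 0" "w \<noteq> 0"
    using assms by (auto simp: parallel_coords z_def w_def)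
  define x y where "x = cmod z" and "y = cmod w"
  have xy: "x > 0" "y > 0" using nz by (auto simp: x_def y_def)
  have sq: "(Re z)\<^sup>2 + (Im z)\<^sup>2 = x\<^sup>2" "(Re w)\<^sup>2 + (Im w)\<^sup>2 = y\<^sup>2"
    by (simp_all add: x_def y_def cmod_power2)
  have u: "(Re z / x)\<^sup>2 + (Im z / x)\<^sup>2 = 1" "(Re w / y)\<^sup>2 + (Im w / y)\<^sup>2 = 1"
    using xy by (simp_all add: power_divide sq flip: add_divide_distrib)
  have c: "(Re z / x) * (Im w / y) - (Im z / x) * (Re w / y) \<noteq> 0"
    using assms xy by (simp add: parallel_coords diff_divide_distrib[symmetric] mult.commute flip: z_def w_def)
  show ?thesis
    using cross_dot_unit_sum[OF u c, of "Re n" "Im n"]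
    by (simp add: bisects_def parallel_def add_divide_distrib flip: z_def w_def x_def y_def)
qed

lemma periodic3_Re_iff:
  "periodic3 c al be th P1 P2 P3 \<longleftrightarrow>
     \<not> parallel (P2 - P1) (P3 - P1) \<and>
     ell_pt c al be th P1 \<and> ell_pt c al be th P2 \<and> ell_pt c al be th P3 \<and>
     (let n1 = ell_normal c al be th P1; n2 = ell_normal c al be th P2; n3 = ell_normal c al be th P3 in
     Re (cnj n1 * (P2 - P1)) / cmod (P2 - P1) = Re (cnj n1 * (P3 - P1)) / cmod (P3 - P1) \<and>
     Re (cnj n2 * (P3 - P2)) / cmod (P3 - P2) = Re (cnj n2 * (P1 - P2)) / cmod (P1 - P2) \<and>
     Re (cnj n3 * (P1 - P3)) / cmod (P1 - P3) = Re (cnj n3 * (P2 - P3)) / cmod (P2 - P3))"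
proof (cases "parallel (P2 - P1) (P3 - P1)")
  case True
  then show ?thesis by (simp add: periodic3_def)
next
  case False
  then have "\<not> parallel (P3 - P2) (P1 - P2)" "\<not> parallel (P1 - P3) (P2 - P3)"
    by (auto simp: parallel_coords algebra_simps)
  with False show ?thesis
    by (simp add: periodic3_def bisects_iff Let_def)
qed

section \<open>Centred conics as quadratic forms\<close>

definition quad :: "real \<Rightarrow> real \<Rightarrow> real \<Rightarrow> complex \<Rightarrow> real" where
  "quad A B C z = A * (Re z)\<^sup>2 + 2 * B * (Re z * Im z) + C * (Im z)\<^sup>2"

text \<open>The symmetric bilinear form whose diagonal is \<open>quad A B C\<close>.\<close>

definition polar :: "real \<Rightarrow> real \<Rightarrow> real \<Rightarrow> complex \<Rightarrow> complex \<Rightarrow> real" where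
  "polar A B C z w = A * (Re z * Re w) + B * (Re z * Im w + Im z * Re w) + C * (Im z * Im w)"

text \<open>The matrix with entries \<open>A\<close>, \<open>B\<close>, \<open>C\<close> is the
  diagonal matrix of \<open>1 / al\<^sup>2\<close> and \<open>1 / be\<^sup>2\<close> conjugated by
  the rotation through \<open>th\<close>. Its trace and determinant keep the semi-axes and forget
  the angle, so semi-axes of different triangles can be compared through two numbers.\<close>

lemma ellipse_quad:
  fixes c :: complex and al be th :: real
  defines "A \<equiv> (cos th)\<^sup>2 / al\<^sup>2 + (sin th)\<^sup>2 / be\<^sup>2"
    and "B \<equiv> cos th * sin th * (1 / al\<^sup>2 - 1 / be\<^sup>2)"
    and "C \<equiv> (sin th)\<^sup>2 / al\<^sup>2 + (cos th)\<^sup>2 / be\<^sup>2"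
  shows "ell_pt c al be th p \<longleftrightarrow> quad A B C (p - c) = 1"
    and "ell_normal c al be th p =
      Complex (A * Re (p - c) + B * Im (p - c)) (B * Re (p - c) + C * Im (p - c))"
    and "A + C = 1 / al\<^sup>2 + 1 / be\<^sup>2"
    and "A * C - B\<^sup>2 = (1 / al\<^sup>2) * (1 / be\<^sup>2)"
proof -
  define i j where "i = 1 / al\<^sup>2" and "j = 1 / be\<^sup>2"
  have ABC: "A = (cos th)\<^sup>2 * i + (sin th)\<^sup>2 * j" "B = cos th * sin th * (i - j)"
    "C = (sin th)\<^sup>2 * i + (cos th)\<^sup>2 * j"
    by (simp_all add: A_def B_def C_def i_def j_def)
  have d: "x / al\<^sup>2 = x * i" "x / be\<^sup>2 = x * j" for x
    by (simp_all add: i_def j_def)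
  show "ell_pt c al be th p \<longleftrightarrow> quad A B C (p - c) = 1"
    unfolding ell_pt_def quad_def Let_def d ABC
    by (simp add: algebra_simps power2_eq_square)
  show "ell_normal c al be th p =
      Complex (A * Re (p - c) + B * Im (p - c)) (B * Re (p - c) + C * Im (p - c))"
    unfolding ell_normal_def Let_def d ABC
    by (simp add: complex_eq_iff algebra_simps power2_eq_square)
  have cs: "(sin th)\<^sup>2 + (cos th)\<^sup>2 = 1" by simp
  show "A + C = 1 / al\<^sup>2 + 1 / be\<^sup>2" unfolding ABC i_def[symmetric] j_def[symmetric]
    using cs by algebra
  show "A * C - B\<^sup>2 = (1 / al\<^sup>2) * (1 / be\<^sup>2)" unfolding ABC i_def[symmetric] j_def[symmetric]
    using cs by algebra
qed

text \<open>Explicit diagonalisation: the eigenvalues are \<open>(A + C) / 2 + R\<close> and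
  \<open>(A + C) / 2 - R\<close>, both positive, and the semi-axes are their inverse square
  roots.\<close>

lemma pos_def_quad_is_ellipse:
  assumes "A > 0" and "A * C - B\<^sup>2 > 0"
  shows "\<exists>al be th. al > 0 \<and> be > 0 \<and> (\<forall>c p. ell_pt c al be th p \<longleftrightarrow> quad A B C (p - c) = 1)"
proof -
  \<comment> \<open>The traceless part of the matrix, read as a complex number, turns by twice the
    angle through which the axes turn. Half its argument is therefore the axis direction.\<close>
  define z where "z = Complex ((A - C) / 2) B"
  define R th where "R = cmod z" and "th = Arg z / 2"
  have "z = of_real R * cis (2 * th)"
    by (simp add: R_def th_def rcis_cmod_Arg flip: rcis_def)
  then have "Re z = R * cos (2 * th)" "Im z = R * sin (2 * th)" by simp_all
  then have RB: "(A - C) / 2 = R * ((cos th)\<^sup>2 - (sin th)\<^sup>2)" "B = R * (2 * sin th * cos th)"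
    by (simp_all only: z_def complex.sel cos_double sin_double)
  have "B\<^sup>2 \<ge> 0" by simp
  then have "A * C > 0" using assms by linarith
  then have C: "C > 0" using assms by (simp add: zero_less_mult_iff)
  \<comment> \<open>The two squares differ by the determinant \<open>A * C - B\<^sup>2\<close>, so
    positivity of the smaller eigenvalue is positivity of the determinant.\<close>
  have "R\<^sup>2 = ((A - C) / 2)\<^sup>2 + B\<^sup>2" by (simp add: R_def z_def cmod_power2)
  also have "\<dots> < ((A + C) / 2)\<^sup>2" using assms(2) by (simp add: power2_eq_square field_simps)
  finally have R: "R < (A + C) / 2"
    by (rule power2_less_imp_less) (use C assms(1) in simp)
  have "R \<ge> 0" by (simp add: R_def)
  define al be where "al = 1 / sqrt ((A + C) / 2 + R)" and "be = 1 / sqrt ((A + C) / 2 - R)"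
  have ev: "(A + C) / 2 + R > 0" "(A + C) / 2 - R > 0" using R \<open>R \<ge> 0\<close> by linarith+
  then have pos: "al > 0" "be > 0" by (simp_all add: al_def be_def)
  have i: "1 / al\<^sup>2 = (A + C) / 2 + R" "1 / be\<^sup>2 = (A + C) / 2 - R"
    using ev by (simp_all add: al_def be_def power_divide)
  have cs: "(sin th)\<^sup>2 + (cos th)\<^sup>2 = 1" by simp
  have split: "s * (M + R) + t * (M - R) = (t + s) * M + R * (s - t)"
    "s * (M + R) + t * (M - R) = (s + t) * M - R * (t - s)" for s t M
    by (simp_all add: algebra_simps)
  have "(cos th)\<^sup>2 / al\<^sup>2 + (sin th)\<^sup>2 / be\<^sup>2 = (cos th)\<^sup>2 * (1 / al\<^sup>2) + (sin th)\<^sup>2 * (1 / be\<^sup>2)" by simp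
  also have "\<dots> = A" unfolding i split(1) cs RB(1)[symmetric] by (simp add: field_simps)
  finally have 1: "(cos th)\<^sup>2 / al\<^sup>2 + (sin th)\<^sup>2 / be\<^sup>2 = A" .
  have "(sin th)\<^sup>2 / al\<^sup>2 + (cos th)\<^sup>2 / be\<^sup>2 = (sin th)\<^sup>2 * (1 / al\<^sup>2) + (cos th)\<^sup>2 * (1 / be\<^sup>2)" by simp
  also have "\<dots> = C" unfolding i split(2) cs RB(1)[symmetric] by (simp add: field_simps)
  finally have 2: "(sin th)\<^sup>2 / al\<^sup>2 + (cos th)\<^sup>2 / be\<^sup>2 = C" .
  have 3: "cos th * sin th * (1 / al\<^sup>2 - 1 / be\<^sup>2) = B"
    unfolding i RB(2) by simp
  show ?thesis
    by (intro exI[of _ al] exI[of _ be] exI[of _ th] conjI allI pos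
      ellipse_quad(1)[of _ al be th, unfolded 1 2 3])
qed

section \<open>The Mittenpunkt and its circumellipse\<close>

lemma cmod_diff_law_of_cosines:
  "(cmod (B - C))\<^sup>2 = (cmod (C - A))\<^sup>2 + (cmod (A - B))\<^sup>2 - 2 * Re (cnj (B - A) * (C - A))"
  by (simp only: cmod_power2) (simp add: power2_eq_square algebra_simps)

text \<open>The squares of the dot and the cross product of two sides add up to the product of their
  squared lengths. The identity serves in both directions: nondegeneracy makes the triangle
  inequalities strict, and positivity of the left side later proves nondegeneracy.\<close>

lemma heron:
  fixes A B C :: complex
  defines "x \<equiv> cmod (B - C)" and "y \<equiv> cmod (C - A)" and "z \<equiv> cmod (A - B)"
  shows "(x + y + z) * ((y + z - x) * (z + x - y) * (x + y - z)) = 4 * (Im (cnj (B - A) * (C - A)))\<^sup>2"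
proof -
  have "(x + y + z) * ((y + z - x) * (z + x - y) * (x + y - z))
    = 4 * (y\<^sup>2 * z\<^sup>2) - (y\<^sup>2 + z\<^sup>2 - x\<^sup>2)\<^sup>2"
    by (simp add: power2_eq_square algebra_simps)
  also have "y\<^sup>2 + z\<^sup>2 - x\<^sup>2 = 2 * Re (cnj (B - A) * (C - A))"
    by (simp add: x_def y_def z_def cmod_diff_law_of_cosines[of B C A])
  also have "4 * (y\<^sup>2 * z\<^sup>2) - (2 * Re (cnj (B - A) * (C - A)))\<^sup>2 = 4 * (Im (cnj (B - A) * (C - A)))\<^sup>2"
  proof -
    have "y\<^sup>2 * z\<^sup>2 = (cmod (cnj (B - A) * (C - A)))\<^sup>2"
      by (simp add: y_def z_def norm_mult power_mult_distrib norm_minus_commute del: complex_cnj_diff)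
    also have "\<dots> = (Re (cnj (B - A) * (C - A)))\<^sup>2 + (Im (cnj (B - A) * (C - A)))\<^sup>2"
      by (rule cmod_power2)
    finally show ?thesis by (simp only: power_mult_distrib) simp
  qed
  finally show ?thesis .
qed

lemma triangle_sides:
  fixes A B C :: complex
  assumes "\<not> parallel (B - A) (C - A)"
  defines "x \<equiv> cmod (B - C)" and "y \<equiv> cmod (C - A)" and "z \<equiv> cmod (A - B)"
  shows "x > 0" "y > 0" "z > 0" "y + z - x > 0" "z + x - y > 0" "x + y - z > 0"
proof -
  have "Im (cnj (B - A) * (C - A)) \<noteq> 0" using assms by (simp add: parallel_def)
  then have "(x + y + z) * ((y + z - x) * (z + x - y) * (x + y - z)) \<noteq> 0"
    unfolding x_def y_def z_def heron by simp
  then have nz: "y + z - x \<noteq> 0" "z + x - y \<noteq> 0" "x + y - z \<noteq> 0" by auto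
  have "x \<le> y + z" "y \<le> z + x" "z \<le> x + y"
    using norm_triangle_ineq[of "B - A" "A - C"] norm_triangle_ineq[of "C - B" "B - A"]
      norm_triangle_ineq[of "A - C" "C - B"]
    by (simp_all add: x_def y_def z_def norm_minus_commute)
  with nz show "y + z - x > 0" "z + x - y > 0" "x + y - z > 0" by linarith+
  then show "x > 0" "y > 0" "z > 0" by linarith+
qed

lemma parallel_in_basis:
  assumes "\<not> parallel e f"
  shows "parallel (of_real p * e + of_real q * f) (of_real r * e + of_real s * f) \<longleftrightarrow> p * s = q * r"
proof -
  have "Im (cnj (of_real p * e + of_real q * f) * (of_real r * e + of_real s * f))
    = (p * s - q * r) * Im (cnj e * f)"
    by (simp add: algebra_simps)
  then show ?thesis using assms by (simp add: parallel_def)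
qed

text \<open>The description in \<open>mittenpunkt\<close> ranges over all points, so its uniqueness
  part needs every candidate in barycentric form. The coordinates come from Cramer's rule.\<close>

lemma barycentric_coords:
  assumes "\<not> parallel (B - A) (C - A)"
  obtains u v w :: real where "u + v + w = 1" "X = of_real u * A + of_real v * B + of_real w * C"
proof -
  define K where "K = Im (cnj (B - A) * (C - A))"
  have K: "K \<noteq> 0" using assms by (simp add: K_def parallel_def)
  define v w where "v = Im (cnj (X - A) * (C - A)) / K" and "w = Im (cnj (B - A) * (X - A)) / K"
  have "of_real K * (X - A) = of_real (v * K) * (B - A) + of_real (w * K) * (C - A)"
    using K by (simp add: v_def w_def complex_eq_iff) (simp add: K_def algebra_simps)
  also have "\<dots> = of_real K * (of_real v * (B - A) + of_real w * (C - A))"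
    by (simp add: algebra_simps)
  finally have "X - A = of_real v * (B - A) + of_real w * (C - A)"
    using K by simp
  then have "X = of_real (1 - v - w) * A + of_real v * B + of_real w * C"
    by (simp add: algebra_simps)
  then show ?thesis by (intro that[of "1 - v - w" v w]) auto
qed

text \<open>Multiplying by \<open>p\<close> clears the denominator of the excenter, after which
  collinearity is a determinant in the basis \<open>B - A\<close>, \<open>C - A\<close>. In this
  form the three lines together say that \<open>2 * u - 1\<close>, \<open>2 * v - 1\<close>,
  \<open>2 * w - 1\<close>, weighted by \<open>y + z - x\<close>, \<open>z + x - y\<close>,
  \<open>x + y - z\<close>, agree.\<close>

lemma on_line_excenter_iff:
  fixes u v w :: real
  assumes nd: "\<not> parallel (B - A) (C - A)" and "u + v + w = 1"
  defines "x \<equiv> cmod (B - C)" and "y \<equiv> cmod (C - A)" and "z \<equiv> cmod (A - B)"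
  shows "on_line (excenter A B C) ((B + C) / 2) (of_real u * A + of_real v * B + of_real w * C)
    \<longleftrightarrow> (z + x - y) * (2 * v - 1) = (x + y - z) * (2 * w - 1)"
proof -
  define p where "p = y + z - x"
  have p: "p > 0" using triangle_sides(4)[OF nd] by (simp add: p_def x_def y_def z_def)
  have E: "excenter A B C = (- of_real x * A + of_real y * B + of_real z * C) / of_real p"
    by (simp add: excenter_def Let_def x_def y_def z_def p_def)
  have u: "u = 1 - v - w" using assms(2) by simp
  define E where "E = excenter A B C"
  have E1: "of_real p * E = - of_real x * A + of_real y * B + of_real z * C"
    using p by (simp add: E_def E)
  have 1: "(B + C) / 2 - E = of_real (1 / 2 - y / p) * (B - A) + of_real (1 / 2 - z / p) * (C - A)"
  proof -
    have "of_real p * ((B + C) / 2 - E)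
      = of_real (p / 2 - y) * (B - A) + of_real (p / 2 - z) * (C - A)"
      unfolding right_diff_distrib E1 by (simp add: p_def field_simps)
    also have "\<dots> = of_real p * (of_real (1 / 2 - y / p) * (B - A) + of_real (1 / 2 - z / p) * (C - A))"
      using p by (simp add: field_simps)
    finally show ?thesis using p by simp
  qed
  have 2: "of_real u * A + of_real v * B + of_real w * C - E
    = of_real (v - y / p) * (B - A) + of_real (w - z / p) * (C - A)"
  proof -
    have "of_real p * (of_real u * A + of_real v * B + of_real w * C - E)
      = of_real (p * v - y) * (B - A) + of_real (p * w - z) * (C - A)"
      unfolding right_diff_distrib E1 u by (simp add: p_def field_simps)
    also have "\<dots> = of_real p * (of_real (v - y / p) * (B - A) + of_real (w - z / p) * (C - A))"
      using p by (simp add: field_simps)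
    finally show ?thesis using p by simp
  qed
  have "on_line E ((B + C) / 2) (of_real u * A + of_real v * B + of_real w * C)
    \<longleftrightarrow> (1 / 2 - y / p) * (w - z / p) = (1 / 2 - z / p) * (v - y / p)"
    unfolding on_line_def 1 2 by (rule parallel_in_basis[OF nd])
  also have "\<dots> \<longleftrightarrow> (p - 2 * y) * (p * w - z) = (p - 2 * z) * (p * v - y)"
    using p by (simp add: field_simps)
  \<comment> \<open>Twice \<open>p * w - z\<close> is \<open>p * (2 * w - 1) + (p - 2 * z)\<close>,
    and likewise for \<open>v\<close>; the product \<open>(p - 2 * y) * (p - 2 * z)\<close> then
    cancels from both sides.\<close>
  also have "\<dots> \<longleftrightarrow> p * ((p - 2 * y) * (2 * w - 1)) = p * ((p - 2 * z) * (2 * v - 1))"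
    by (auto simp: algebra_simps)
  also have "\<dots> \<longleftrightarrow> (z + x - y) * (2 * v - 1) = (x + y - z) * (2 * w - 1)"
  proof -
    have "p - 2 * y = - (x + y - z)" "p - 2 * z = - (z + x - y)" by (simp_all add: p_def)
    then have "(p - 2 * y) * (2 * w - 1) = - ((x + y - z) * (2 * w - 1))"
      "(p - 2 * z) * (2 * v - 1) = - ((z + x - y) * (2 * v - 1))" by (simp_all only: mult_minus_left)
    then show ?thesis using p by (metis mult_left_cancel neg_equal_iff_equal less_irrefl)
  qed
  finally show ?thesis unfolding E_def .
qed

text \<open>The three lines give a linear system with exactly one solution among normalised weights.
  This supplies existence and uniqueness for the definite description at once.\<close>

lemma mittenpunkt_barycentric:
  fixes A B C :: complex
  assumes nd: "\<not> parallel (B - A) (C - A)"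
  defines "x \<equiv> cmod (B - C)" and "y \<equiv> cmod (C - A)" and "z \<equiv> cmod (A - B)"
  defines "s \<equiv> 2 * (x * y + y * z + z * x) - (x\<^sup>2 + y\<^sup>2 + z\<^sup>2)"
  shows "mittenpunkt A B C = of_real (x * (y + z - x) / s) * A + of_real (y * (z + x - y) / s) * B
    + of_real (z * (x + y - z) / s) * C"
proof -
  note sides = triangle_sides[OF nd, folded x_def y_def z_def]
  have ndB: "\<not> parallel (C - B) (A - B)" and ndC: "\<not> parallel (A - C) (B - C)"
    using nd by (auto simp: parallel_coords algebra_simps)
  \<comment> \<open>Twice the tangent lengths from the vertices to the incircle; in them
    \<open>s\<close> is visibly positive.\<close>
  define p q r where "p = y + z - x" and "q = z + x - y" and "r = x + y - z"
  have pos: "p > 0" "q > 0" "r > 0" using sides by (auto simp: p_def q_def r_def)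
  have s: "s = p * q + q * r + r * p"
    by (simp add: s_def p_def q_def r_def power2_eq_square algebra_simps)
  have s0: "s > 0" unfolding s using pos by (intro add_pos_pos mult_pos_pos)
  define u0 v0 w0 where "u0 = x * p / s" and "v0 = y * q / s" and "w0 = z * r / s"
  have sol: "(q * (2 * v - 1) = r * (2 * w - 1) \<and> r * (2 * w - 1) = p * (2 * u - 1)
      \<and> p * (2 * u - 1) = q * (2 * v - 1))
    \<longleftrightarrow> u = u0 \<and> v = v0 \<and> w = w0" if "u + v + w = 1" for u v w
  proof
    assume t: "q * (2 * v - 1) = r * (2 * w - 1) \<and> r * (2 * w - 1) = p * (2 * u - 1)
      \<and> p * (2 * u - 1) = q * (2 * v - 1)"
    define T where "T = p * (2 * u - 1)"
    have T: "p * (2 * u - 1) = T" "q * (2 * v - 1) = T" "r * (2 * w - 1) = T"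
      using t unfolding T_def by linarith+
    \<comment> \<open>The quantities \<open>2 * u - 1\<close>, \<open>2 * v - 1\<close>,
      \<open>2 * w - 1\<close> sum to -1, which fixes the common value \<open>T\<close>.\<close>
    have "T * s = (q * r) * T + (p * r) * T + (p * q) * T"
      by (simp add: s algebra_simps)
    also have "\<dots> = (q * r) * (p * (2 * u - 1)) + (p * r) * (q * (2 * v - 1)) + (p * q) * (r * (2 * w - 1))"
      by (simp only: T)
    also have "\<dots> = p * q * r * (2 * (u + v + w) - 3)" by (simp add: algebra_simps)
    also have "\<dots> = - (p * q * r)" by (simp add: that)
    finally have "T * s = - (p * q * r)" .
    then have "p * ((2 * u - 1) * s) = p * (- (q * r))" "q * ((2 * v - 1) * s) = q * (- (p * r))"
      "r * ((2 * w - 1) * s) = r * (- (p * q))"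
      unfolding mult.assoc[symmetric] T by (simp_all add: mult_ac)
    then have "(2 * u - 1) * s = - (q * r)" "(2 * v - 1) * s = - (p * r)" "(2 * w - 1) * s = - (p * q)"
      using pos by (metis mult_left_cancel less_irrefl)+
    then have "2 * (u * s) = p * (q + r)" "2 * (v * s) = q * (p + r)" "2 * (w * s) = r * (p + q)"
      unfolding s by (simp_all add: algebra_simps)
    moreover have "q + r = 2 * x" "p + r = 2 * y" "p + q = 2 * z" by (simp_all add: p_def q_def r_def)
    ultimately have "u * s = x * p" "v * s = y * q" "w * s = z * r" by simp_all
    with s0 show "u = u0 \<and> v = v0 \<and> w = w0"
      by (simp add: u0_def v0_def w0_def field_simps)
  next
    assume eq: "u = u0 \<and> v = v0 \<and> w = w0"
    have "2 * u0 - 1 = - (q * r) / s" "2 * v0 - 1 = - (p * r) / s" "2 * w0 - 1 = - (p * q) / s"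
    proof -
      have "2 * t / s - 1 = (2 * t - s) / s" for t using s0 by (simp add: diff_divide_distrib)
      moreover have "2 * (x * p) - s = - (q * r)" "2 * (y * q) - s = - (p * r)" "2 * (z * r) - s = - (p * q)"
        by (simp_all add: s_def p_def q_def r_def power2_eq_square algebra_simps)
      ultimately show "2 * u0 - 1 = - (q * r) / s" "2 * v0 - 1 = - (p * r) / s" "2 * w0 - 1 = - (p * q) / s"
        unfolding u0_def v0_def w0_def times_divide_eq_right by simp_all
    qed
    then show "q * (2 * v - 1) = r * (2 * w - 1) \<and> r * (2 * w - 1) = p * (2 * u - 1)
      \<and> p * (2 * u - 1) = q * (2 * v - 1)"
      by (simp add: eq)
  qed
  have "u0 + v0 + w0 = (x * p + y * q + z * r) / s"
    by (simp add: u0_def v0_def w0_def add_divide_distrib)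
  also have "x * p + y * q + z * r = s"
    by (simp add: s_def p_def q_def r_def power2_eq_square algebra_simps)
  finally have sum0: "u0 + v0 + w0 = 1" using s0 by simp
  let ?P = "\<lambda>X. on_line (excenter A B C) ((B + C) / 2) X \<and>
             on_line (excenter B C A) ((C + A) / 2) X \<and>
             on_line (excenter C A B) ((A + B) / 2) X"
  have char: "?P (of_real u * A + of_real v * B + of_real w * C) \<longleftrightarrow> u = u0 \<and> v = v0 \<and> w = w0"
    if "u + v + w = 1" for u v w
  proof -
    have A: "on_line (excenter A B C) ((B + C) / 2) (of_real u * A + of_real v * B + of_real w * C)
      \<longleftrightarrow> q * (2 * v - 1) = r * (2 * w - 1)"
      using on_line_excenter_iff[OF nd, of u v w] that by (simp add: q_def r_def x_def y_def z_def)
    have B: "on_line (excenter B C A) ((C + A) / 2) (of_real u * A + of_real v * B + of_real w * C)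
      \<longleftrightarrow> r * (2 * w - 1) = p * (2 * u - 1)"
      using on_line_excenter_iff[OF ndB, of v w u] that
      by (simp add: p_def r_def x_def y_def z_def add_ac)
    have C: "on_line (excenter C A B) ((A + B) / 2) (of_real u * A + of_real v * B + of_real w * C)
      \<longleftrightarrow> p * (2 * u - 1) = q * (2 * v - 1)"
      using on_line_excenter_iff[OF ndC, of w u v] that
      by (simp add: p_def q_def x_def y_def z_def add_ac)
    show ?thesis unfolding A B C sol[OF that] by (rule refl)
  qed
  have "mittenpunkt A B C = of_real u0 * A + of_real v0 * B + of_real w0 * C"
    unfolding mittenpunkt_def
  proof (rule the_equality)
    show "?P (of_real u0 * A + of_real v0 * B + of_real w0 * C)"
      unfolding char[OF sum0] by simp
  next
    fix X assume X: "?P X"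
    obtain u v w where "u + v + w = 1" "X = of_real u * A + of_real v * B + of_real w * C"
      using barycentric_coords[OF nd] by blast
    with X char[of u v w] show "X = of_real u0 * A + of_real v0 * B + of_real w0 * C" by simp
  qed
  then show ?thesis by (simp only: u0_def v0_def w0_def p_def q_def r_def)
qed

section \<open>Quadratic forms measured on two sides of a triangle\<close>

lemma quad_combination:
  "quad A B C (of_real r * e + of_real s * f) =
     r\<^sup>2 * quad A B C e + 2 * (r * s) * polar A B C e f + s\<^sup>2 * quad A B C f"
  by (simp add: quad_def polar_def power2_eq_square algebra_simps)

text \<open>Determinant of the Gram matrix of the form in the basis \<open>e\<close>,
  \<open>f\<close>: the base change contributes the square of the cross product.\<close>

lemma quad_gram_det:
  "quad A B C e * quad A B C f - (polar A B C e f)\<^sup>2 = (A * C - B\<^sup>2) * (Im (cnj e * f))\<^sup>2"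
  by (simp add: quad_def polar_def power2_eq_square algebra_simps)

text \<open>The left side is the trace of the Gram matrix of the form times the adjugate of the
  Euclidean Gram matrix. It recovers the trace of the form from its values on two sides.\<close>

lemma quad_gram_trace:
  "quad A B C e * (cmod f)\<^sup>2 + quad A B C f * (cmod e)\<^sup>2 - 2 * polar A B C e f * Re (cnj e * f)
     = (A + C) * (Im (cnj e * f))\<^sup>2"
  unfolding cmod_power2 by (simp add: quad_def polar_def power2_eq_square algebra_simps)

lemma quad_diff: "quad A B C (w - z) = quad A B C w - 2 * polar A B C w z + quad A B C z"
  by (simp add: quad_def polar_def power2_eq_square algebra_simps)

lemma quad_minus: "quad A B C (- z) = quad A B C z"
  by (simp add: quad_def)

lemma exists_quad_gram:
  assumes "Im (cnj e * f) \<noteq> 0"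
  shows "\<exists>A B C. quad A B C e = g \<and> quad A B C f = h \<and> polar A B C e f = k"
proof -
  define K where "K = Im (cnj e * f)"
  have K: "K \<noteq> 0" using assms by (simp add: K_def)
  \<comment> \<open>These are the entries of the Gram matrix transported back by the inverse of the
    matrix with columns \<open>e\<close> and \<open>f\<close>.\<close>
  define A B C where "A = (g * (Im f)\<^sup>2 - 2 * k * Im e * Im f + h * (Im e)\<^sup>2) / K\<^sup>2"
    and "B = (- g * Re f * Im f + k * (Im f * Re e + Re f * Im e) - h * Re e * Im e) / K\<^sup>2"
    and "C = (g * (Re f)\<^sup>2 - 2 * k * Re e * Re f + h * (Re e)\<^sup>2) / K\<^sup>2"
  have d: "A * t1 + B * t2 + C * t3 = ((A * K\<^sup>2) * t1 + (B * K\<^sup>2) * t2 + (C * K\<^sup>2) * t3) / K\<^sup>2" for t1 t2 t3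
    using K by (simp add: field_simps)
  have m: "A * K\<^sup>2 = g * (Im f)\<^sup>2 - 2 * k * Im e * Im f + h * (Im e)\<^sup>2"
    "B * K\<^sup>2 = - g * Re f * Im f + k * (Im f * Re e + Re f * Im e) - h * Re e * Im e"
    "C * K\<^sup>2 = g * (Re f)\<^sup>2 - 2 * k * Re e * Re f + h * (Re e)\<^sup>2"
    using K by (simp_all add: A_def B_def C_def)
  have Kd: "K = Re e * Im f - Im e * Re f" by (simp add: K_def)
  have "quad A B C e = A * (Re e)\<^sup>2 + B * (2 * (Re e * Im e)) + C * (Im e)\<^sup>2"
    by (simp add: quad_def)
  also have "\<dots> = (g * K\<^sup>2) / K\<^sup>2"
    unfolding d m unfolding Kd by (rule arg_cong2[where f = "(/)"], algebra, rule refl)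
  finally have 1: "quad A B C e = g" using K by simp
  have "quad A B C f = A * (Re f)\<^sup>2 + B * (2 * (Re f * Im f)) + C * (Im f)\<^sup>2"
    by (simp add: quad_def)
  also have "\<dots> = (h * K\<^sup>2) / K\<^sup>2"
    unfolding d m unfolding Kd by (rule arg_cong2[where f = "(/)"], algebra, rule refl)
  finally have 2: "quad A B C f = h" using K by simp
  have "polar A B C e f = (k * K\<^sup>2) / K\<^sup>2"
    unfolding polar_def d m unfolding Kd by (rule arg_cong2[where f = "(/)"], algebra, rule refl)
  then have "polar A B C e f = k" using K by simp
  with 1 2 show ?thesis by blast
qed

text \<open>Given its centre, a circumconic is determined by three linear equations.  For the
  barycentric weights of the Mittenpunkt the solution is proportional to the side lengths,
  which is why the external angle bisectors are the tangents at the vertices.\<close>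

lemma mittenpunkt_circumconic_equations:
  fixes x y z k l m :: real
  assumes pos: "x > 0" "y > 0" "z > 0" "y + z - x > 0" "z + x - y > 0" "x + y - z > 0"
  defines "s \<equiv> 2 * (x * y + y * z + z * x) - (x\<^sup>2 + y\<^sup>2 + z\<^sup>2)"
  defines "v \<equiv> y * (z + x - y) / s" and "w \<equiv> z * (x + y - z) / s"
  shows "v\<^sup>2 * k + 2 * (v * w) * m + w\<^sup>2 * l = 1 \<and>
    (1 - v)\<^sup>2 * k - 2 * ((1 - v) * w) * m + w\<^sup>2 * l = 1 \<and>
    v\<^sup>2 * k - 2 * (v * (1 - w)) * m + (1 - w)\<^sup>2 * l = 1 \<longleftrightarrow>
    k = s / (x * y * z) * z \<and> l = s / (x * y * z) * y \<and> 2 * m = s / (x * y * z) * (y + z - x)"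
    (is "?L \<longleftrightarrow> ?R")
proof -
  define p q r where "p = y + z - x" and "q = z + x - y" and "r = x + y - z"
  have pqr: "p > 0" "q > 0" "r > 0" using pos by (auto simp: p_def q_def r_def)
  have s: "s = p * q + q * r + r * p"
    by (simp add: s_def p_def q_def r_def power2_eq_square algebra_simps)
  have s0: "s > 0" unfolding s using pqr by (intro add_pos_pos mult_pos_pos)
  have vw: "v = y * q / s" "w = z * r / s" by (simp_all add: v_def w_def q_def r_def)
  have a1: "1 - 2 * v = p * r / s" "1 - 2 * w = p * q / s"
  proof -
    have "1 - 2 * (t / s) = (s - 2 * t) / s" for t using s0 by (simp add: diff_divide_distrib)
    moreover have "s - 2 * (y * q) = p * r" "s - 2 * (z * r) = p * q"
      by (simp_all add: s_def p_def q_def r_def power2_eq_square algebra_simps)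
    ultimately show "1 - 2 * v = p * r / s" "1 - 2 * w = p * q / s"
      unfolding vw by simp_all
  qed
  \<comment> \<open>Subtracting the first equation from the other two leaves homogeneous
    equations.\<close>
  have "?L \<longleftrightarrow> v\<^sup>2 * k + 2 * (v * w) * m + w\<^sup>2 * l = 1 \<and>
    (1 - 2 * v) * k = 2 * w * m \<and> (1 - 2 * w) * l = 2 * v * m"
    by (auto simp: power2_eq_square algebra_simps)
  also have "\<dots> \<longleftrightarrow> v\<^sup>2 * k + 2 * (v * w) * m + w\<^sup>2 * l = 1 \<and> p * k = 2 * z * m \<and> p * l = 2 * y * m"
    unfolding a1 using s0 pqr by (auto simp: vw)
  also have "\<dots> \<longleftrightarrow> ?R"
  proof -
    have key: "v\<^sup>2 * z + v * w * p + w\<^sup>2 * y = x * y * z / s"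
    proof -
      have "v\<^sup>2 * z + v * w * p + w\<^sup>2 * y = (y * q * (y * q) * z + y * q * (z * r) * p + z * r * (z * r) * y) / (s * s)"
        unfolding vw by (simp add: power2_eq_square add_divide_distrib)
      also have "y * q * (y * q) * z + y * q * (z * r) * p + z * r * (z * r) * y = x * y * z * s"
        by (simp add: s_def p_def q_def r_def power2_eq_square algebra_simps)
      finally show ?thesis using s0 by simp
    qed
    \<comment> \<open>The homogeneous equations make \<open>k\<close>, \<open>l\<close>,
      \<open>2 * m\<close> proportional to \<open>z\<close>, \<open>y\<close>, \<open>p\<close>; the
      first equation, through \<open>key\<close>, fixes the ratio \<open>t\<close>.\<close>
    define t where "t = 2 * m / p"
    have m: "2 * m = t * p" using pqr by (simp add: t_def)
    have e1: "p * k = 2 * z * m \<longleftrightarrow> k = t * z" "p * l = 2 * y * m \<longleftrightarrow> l = t * y"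
      using pqr m by (auto simp: t_def field_simps)
    have "v\<^sup>2 * k + 2 * (v * w) * m + w\<^sup>2 * l = t * (x * y * z / s)" if "k = t * z" "l = t * y"
      using m key unfolding that by algebra
    then have "(v\<^sup>2 * k + 2 * (v * w) * m + w\<^sup>2 * l = 1 \<and> k = t * z \<and> l = t * y)
      \<longleftrightarrow> (t * (x * y * z / s) = 1 \<and> k = t * z \<and> l = t * y)"
      by auto
    also have "t * (x * y * z / s) = 1 \<longleftrightarrow> t = s / (x * y * z)"
      using s0 pos(1-3) by (auto simp: field_simps)
    also have "(t = s / (x * y * z) \<and> k = t * z \<and> l = t * y) \<longleftrightarrow> ?R"
    proof -
      have "2 * m = T * (y + z - x) \<longleftrightarrow> t = T" for T
        using m pqr by (simp add: p_def)
      then show ?thesis by metis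
    qed
    finally show ?thesis unfolding e1 .
  qed
  finally show ?thesis .
qed

text \<open>In the basis \<open>Q - P\<close>, \<open>R - P\<close> the vectors from
  \<open>X\<close> to the vertices have the barycentric weights as coefficients, so incidence is the
  linear system solved above. The form then takes on both basis sides the value \<open>S\<close>
  times the length.\<close>

lemma mittenpunkt_circumconic_iff:
  fixes P Q R :: complex and A B C :: real
  assumes nd: "\<not> parallel (Q - P) (R - P)"
  defines "x \<equiv> cmod (Q - R)" and "y \<equiv> cmod (R - P)" and "z \<equiv> cmod (P - Q)"
  defines "S \<equiv> (2 * (x * y + y * z + z * x) - (x\<^sup>2 + y\<^sup>2 + z\<^sup>2)) / (x * y * z)"
    and "X \<equiv> mittenpunkt P Q R"
  shows "quad A B C (P - X) = 1 \<and> quad A B C (Q - X) = 1 \<and> quad A B C (R - X) = 1 \<longleftrightarrow>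
    quad A B C (Q - P) = S * z \<and> quad A B C (R - P) = S * y \<and>
    2 * polar A B C (Q - P) (R - P) = S * (y + z - x)"
proof -
  note sides = triangle_sides[OF nd, folded x_def y_def z_def]
  define s where "s = 2 * (x * y + y * z + z * x) - (x\<^sup>2 + y\<^sup>2 + z\<^sup>2)"
  define p q r where "p = y + z - x" and "q = z + x - y" and "r = x + y - z"
  have pqr: "p > 0" "q > 0" "r > 0" using sides by (auto simp: p_def q_def r_def)
  have s: "s = p * q + q * r + r * p"
    by (simp add: s_def p_def q_def r_def power2_eq_square algebra_simps)
  have s0: "s > 0" unfolding s using pqr by (intro add_pos_pos mult_pos_pos)
  define u v w where "u = x * p / s" and "v = y * q / s" and "w = z * r / s"
  have "u + v + w = (x * p + y * q + z * r) / s"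
    by (simp add: u_def v_def w_def add_divide_distrib)
  also have "x * p + y * q + z * r = s"
    by (simp add: s_def p_def q_def r_def power2_eq_square algebra_simps)
  finally have u: "u = 1 - v - w" using s0 by simp
  have X: "X = of_real u * P + of_real v * Q + of_real w * R"
    unfolding X_def mittenpunkt_barycentric[OF nd] u_def v_def w_def p_def q_def r_def s_def
      x_def y_def z_def ..
  have "P - X = of_real (- v) * (Q - P) + of_real (- w) * (R - P)"
    "Q - X = of_real (1 - v) * (Q - P) + of_real (- w) * (R - P)"
    "R - X = of_real (- v) * (Q - P) + of_real (1 - w) * (R - P)"
    unfolding X u by (simp_all add: algebra_simps)
  note PQR = this
  show ?thesis
    unfolding PQR quad_combination
    using mittenpunkt_circumconic_equations[OF sides, of "quad A B C (Q - P)" "polar A B C (Q - P) (R - P)" "quad A B C (R - P)"]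
    by (simp add: S_def v_def w_def p_def q_def r_def s_def)
qed

lemma polar_normal:
  "Re (cnj (Complex (A * Re z + B * Im z) (B * Re z + C * Im z)) * w) = polar A B C z w"
  by (simp add: polar_def algebra_simps)

text \<open>On every side the form equals \<open>S\<close> times the length, while the normal at a
  vertex pairs with a chord to minus half the form of that chord. All unit chords thus have normal
  component \<open>- S / 2\<close>, which is the reflection law. Trace and determinant follow from
  the Gram identities, with Heron's formula for the cross product.\<close>

lemma mittenpunkt_circumellipse:
  fixes P Q R :: complex
  assumes nd: "\<not> parallel (Q - P) (R - P)"
  defines "x \<equiv> cmod (Q - R)" and "y \<equiv> cmod (R - P)" and "z \<equiv> cmod (P - Q)"
  defines "L \<equiv> x + y + z"
    and "S \<equiv> (2 * (x * y + y * z + z * x) - (x\<^sup>2 + y\<^sup>2 + z\<^sup>2)) / (x * y * z)"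
    and "X \<equiv> mittenpunkt P Q R"
  shows "\<exists>al be th. al > 0 \<and> be > 0 \<and>
      ell_pt X al be th P \<and> ell_pt X al be th Q \<and> ell_pt X al be th R"
    and "\<And>al be th. ell_pt X al be th P \<Longrightarrow> ell_pt X al be th Q \<Longrightarrow> ell_pt X al be th R \<Longrightarrow>
      1 / al\<^sup>2 + 1 / be\<^sup>2 = 2 * S * (L * S - 6) / (L * (L * S - 8)) \<and>
      (1 / al\<^sup>2) * (1 / be\<^sup>2) = S ^ 3 / (L * (L * S - 8)) \<and>
      periodic3 X al be th P Q R"
proof -
  note sides = triangle_sides[OF nd, folded x_def y_def z_def]
  define s where "s = 2 * (x * y + y * z + z * x) - (x\<^sup>2 + y\<^sup>2 + z\<^sup>2)"
  define p q r where "p = y + z - x" and "q = z + x - y" and "r = x + y - z"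
  have pqr: "p > 0" "q > 0" "r > 0" using sides by (auto simp: p_def q_def r_def)
  have s: "s = p * q + q * r + r * p"
    by (simp add: s_def p_def q_def r_def power2_eq_square algebra_simps)
  have s0: "s > 0" unfolding s using pqr by (intro add_pos_pos mult_pos_pos)
  have Ss: "S * (x * y * z) = s" using sides(1-3) by (simp add: S_def s_def)
  have S0: "S > 0" unfolding S_def s_def[symmetric] using s0 sides(1-3) by simp
  define K where "K = Im (cnj (Q - P) * (R - P))"
  have K0: "K \<noteq> 0" using nd by (simp add: K_def parallel_def)
  have K: "4 * K\<^sup>2 = L * (p * q * r)"
    using heron[of Q R P] unfolding K_def L_def p_def q_def r_def x_def y_def z_def by simp
  \<comment> \<open>Expresses Heron's product through \<open>L\<close> and \<open>S\<close>; this is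
    where the threshold 8 comes from.\<close>
  have pqr': "p * q * r = (L * S - 8) * (x * y * z)"
  proof -
    have "p * q * r = L * s - 8 * (x * y * z)"
      by (simp add: L_def p_def q_def r_def s_def power2_eq_square algebra_simps)
    then show ?thesis using Ss by (simp add: algebra_simps)
  qed
  have K': "4 * K\<^sup>2 = L * (L * S - 8) * (x * y * z)" using K pqr' by simp
  have LS0: "L * (L * S - 8) \<noteq> 0" using K' K0 by auto
  note iff = mittenpunkt_circumconic_iff[OF nd, folded x_def y_def z_def, folded S_def X_def]
  have detG: "(S * z) * (S * y) - (S * (y + z - x) / 2)\<^sup>2 = S\<^sup>2 * s / 4"
    by (simp add: s_def power2_eq_square field_simps)
  show "\<exists>al be th. al > 0 \<and> be > 0 \<and>
      ell_pt X al be th P \<and> ell_pt X al be th Q \<and> ell_pt X al be th R"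
  proof -
    obtain A B C where G: "quad A B C (Q - P) = S * z" "quad A B C (R - P) = S * y"
      "polar A B C (Q - P) (R - P) = S * (y + z - x) / 2"
      using exists_quad_gram K0 unfolding K_def by blast
    have on: "quad A B C (P - X) = 1" "quad A B C (Q - X) = 1" "quad A B C (R - X) = 1"
      using iff[of A B C] G by auto
    have "(A * C - B\<^sup>2) * K\<^sup>2 = S\<^sup>2 * s / 4"
      using quad_gram_det[of A B C "Q - P" "R - P"] detG unfolding G K_def by simp
    moreover have "S\<^sup>2 * s / 4 > 0" using S0 s0 by simp
    ultimately have d: "A * C - B\<^sup>2 > 0" using K0 by (metis zero_less_mult_pos2 zero_less_power2)
    \<comment> \<open>Completing the square: with a positive determinant, one positive value of the
      form forces \<open>A\<close> to be positive.\<close>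
    have "A * quad A B C (Q - P) = (A * Re (Q - P) + B * Im (Q - P))\<^sup>2 + (A * C - B\<^sup>2) * (Im (Q - P))\<^sup>2"
      by (simp add: quad_def power2_eq_square algebra_simps)
    also have "\<dots> \<ge> 0" using d by simp
    finally have "0 \<le> A * (S * z)" unfolding G .
    then have "A \<ge> 0" using S0 sides(3) by (simp add: zero_le_mult_iff mult_le_0_iff)
    moreover have "A \<noteq> 0" using d by (auto simp: not_less)
    ultimately have "A > 0" by simp
    from pos_def_quad_is_ellipse[OF this d] on show ?thesis by blast
  qed
  fix al be th
  assume on: "ell_pt X al be th P" "ell_pt X al be th Q" "ell_pt X al be th R"
  define A where "A = (cos th)\<^sup>2 / al\<^sup>2 + (sin th)\<^sup>2 / be\<^sup>2"
  define B where "B = cos th * sin th * (1 / al\<^sup>2 - 1 / be\<^sup>2)"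
  define C where "C = (sin th)\<^sup>2 / al\<^sup>2 + (cos th)\<^sup>2 / be\<^sup>2"
  note ell = ellipse_quad[where al = al and be = be and th = th, folded A_def B_def C_def]
  have q1: "quad A B C (P - X) = 1" "quad A B C (Q - X) = 1" "quad A B C (R - X) = 1"
    using on by (simp_all add: ell)
  then have G: "quad A B C (Q - P) = S * z" "quad A B C (R - P) = S * y"
    "polar A B C (Q - P) (R - P) = S * (y + z - x) / 2"
    using iff[of A B C] by auto
  have "(A * C - B\<^sup>2) * (4 * K\<^sup>2) = S\<^sup>2 * s"
    using quad_gram_det[of A B C "Q - P" "R - P"] detG unfolding G K_def by simp
  then have "((A * C - B\<^sup>2) * (L * (L * S - 8))) * (x * y * z) = S ^ 3 * (x * y * z)"
    unfolding K' Ss[symmetric] by (simp add: power2_eq_square power3_eq_cube algebra_simps)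
  then have "(A * C - B\<^sup>2) * (L * (L * S - 8)) = S ^ 3" using sides by simp
  then have det: "A * C - B\<^sup>2 = S ^ 3 / (L * (L * S - 8))" using LS0 by (simp add: field_simps)
  have dot: "Re (cnj (Q - P) * (R - P)) = (y\<^sup>2 + z\<^sup>2 - x\<^sup>2) / 2"
    unfolding x_def y_def z_def cmod_diff_law_of_cosines[of Q R P] by simp
  have cm: "cmod (Q - P) = z" "cmod (R - P) = y" by (simp_all add: y_def z_def norm_minus_commute)
  have "(A + C) * (4 * K\<^sup>2) = 4 * (S * z * y\<^sup>2 + S * y * z\<^sup>2 - 2 * (S * (y + z - x) / 2) * ((y\<^sup>2 + z\<^sup>2 - x\<^sup>2) / 2))"
    using quad_gram_trace[of A B C "Q - P" "R - P"] unfolding G dot cm K_def by simp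
  also have "\<dots> = 2 * S * (p * q * r + 2 * (x * y * z))"
    by (simp add: p_def q_def r_def power2_eq_square field_simps)
  also have "\<dots> = 2 * S * (L * S - 6) * (x * y * z)"
    unfolding pqr' by (simp add: algebra_simps)
  finally have "(A + C) * (L * (L * S - 8)) = 2 * S * (L * S - 6)"
    unfolding K' using sides by simp
  then have tr: "A + C = 2 * S * (L * S - 6) / (L * (L * S - 8))" using LS0 by (simp add: field_simps)
  have G3: "quad A B C (R - Q) = S * x"
  proof -
    have "R - Q = (R - P) - (Q - P)" by simp
    then have "quad A B C (R - Q) = quad A B C (R - P) - 2 * polar A B C (R - P) (Q - P) + quad A B C (Q - P)"
      by (metis quad_diff)
    also have "polar A B C (R - P) (Q - P) = polar A B C (Q - P) (R - P)"
      by (simp add: polar_def algebra_simps)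
    finally show ?thesis unfolding G by (simp add: field_simps)
  qed
  \<comment> \<open>Expanding the form at \<open>V - X\<close>, the sum of \<open>U - X\<close> and
    \<open>V - U\<close>, the two values 1 cancel.\<close>
  have chord: "polar A B C (U - X) (V - U) = - quad A B C (V - U) / 2"
    if "quad A B C (U - X) = 1" "quad A B C (V - X) = 1" for U V
    using that by (simp add: quad_def polar_def power2_eq_square field_simps)
  have G': "quad A B C (P - Q) = S * z" "quad A B C (P - R) = S * y" "quad A B C (Q - R) = S * x"
    using G(1,2) G3 quad_minus[of A B C] by (metis minus_diff_eq)+
  have "periodic3 X al be th P Q R"
    unfolding periodic3_Re_iff Let_def ell(2) polar_normal
    using sides(1-3) nd on
    by (simp add: chord q1 G G3 G' cm norm_minus_commute[of R Q] norm_minus_commute[of P R] flip: x_def y_def z_def)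
  then show "1 / al\<^sup>2 + 1 / be\<^sup>2 = 2 * S * (L * S - 6) / (L * (L * S - 8)) \<and>
      (1 / al\<^sup>2) * (1 / be\<^sup>2) = S ^ 3 / (L * (L * S - 8)) \<and>
      periodic3 X al be th P Q R"
    using ell(3,4) det tr by metis
qed

section \<open>Three-periodic billiard trajectories\<close>

text \<open>The affine map onto the unit circle; its value is the parameter \<open>u\<close> of the
  point, with the eccentric anomaly as argument.\<close>

definition ell_unit :: "real \<Rightarrow> real \<Rightarrow> complex \<Rightarrow> complex" where
  "ell_unit a b P = Complex (Re P / a) (Im P / b)"

lemma cmod_ell_unit: "ell_pt 0 a b 0 P \<longleftrightarrow> cmod (ell_unit a b P) = 1"
proof -
  have "ell_pt 0 a b 0 P \<longleftrightarrow> (cmod (ell_unit a b P))\<^sup>2 = 1"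
    by (simp add: ell_pt_def ell_unit_def cmod_power2 power_divide)
  also have "\<dots> \<longleftrightarrow> cmod (ell_unit a b P) = 1"
    by (simp add: power2_eq_1_iff) (metis norm_ge_zero neg_0_le_iff_le not_one_le_zero)
  finally show ?thesis .
qed

text \<open>After rescaling, the pairing becomes the dot product of a unit vector with the chord to
  another unit vector, which is minus half the squared chord.\<close>

lemma normal_dot_chord:
  assumes "a \<noteq> 0" "b \<noteq> 0" "ell_pt 0 a b 0 P" "ell_pt 0 a b 0 Q"
  shows "Re (cnj (ell_normal 0 a b 0 P) * (Q - P)) = - (cmod (ell_unit a b P - ell_unit a b Q))\<^sup>2 / 2"
proof -
  define x y x' y' where "x = Re P / a" and "y = Im P / b" and "x' = Re Q / a" and "y' = Im Q / b"
  have "x\<^sup>2 + y\<^sup>2 = 1" "x'\<^sup>2 + y'\<^sup>2 = 1"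
    using assms(3,4) by (simp_all add: ell_pt_def power_divide x_def y_def x'_def y'_def)
  then have "x * (x' - x) + y * (y' - y) = - ((x - x')\<^sup>2 + (y - y')\<^sup>2) / 2"
    by (simp add: power2_eq_square algebra_simps)
  moreover have "Re (cnj (ell_normal 0 a b 0 P) * (Q - P)) = x * (x' - x) + y * (y' - y)"
    using assms(1,2)
    by (simp add: ell_normal_def x_def y_def x'_def y'_def power2_eq_square field_simps)
  moreover have "(cmod (ell_unit a b P - ell_unit a b Q))\<^sup>2 = (x - x')\<^sup>2 + (y - y')\<^sup>2"
    unfolding cmod_power2 by (simp add: ell_unit_def x_def y_def x'_def y'_def)
  ultimately show ?thesis by simp
qed

text \<open>By the previous identity the reflection law at a vertex equates the ratio of squared
  unit-circle chord to side length on the two sides meeting there. Two vertices link all three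
  sides; the common ratio is \<open>2 * J\<close>.\<close>

lemma periodic3_joachimsthal:
  assumes "a > 0" "b > 0" "periodic3 0 a b 0 P1 P2 P3"
  obtains J where "J > 0"
    "2 * J * cmod (P1 - P2) = (cmod (ell_unit a b P1 - ell_unit a b P2))\<^sup>2"
    "2 * J * cmod (P2 - P3) = (cmod (ell_unit a b P2 - ell_unit a b P3))\<^sup>2"
    "2 * J * cmod (P3 - P1) = (cmod (ell_unit a b P3 - ell_unit a b P1))\<^sup>2"
proof -
  define w12 where "w12 = (cmod (ell_unit a b P1 - ell_unit a b P2))\<^sup>2"
  define w23 where "w23 = (cmod (ell_unit a b P2 - ell_unit a b P3))\<^sup>2"
  define w31 where "w31 = (cmod (ell_unit a b P3 - ell_unit a b P1))\<^sup>2"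
  have nd: "\<not> parallel (P2 - P1) (P3 - P1)"
    and on: "ell_pt 0 a b 0 P1" "ell_pt 0 a b 0 P2" "ell_pt 0 a b 0 P3"
    using assms(3) by (simp_all add: periodic3_def)
  note sides = triangle_sides(1-3)[OF nd]
  have n: "Re (cnj (ell_normal 0 a b 0 P) * (Q - P)) = - (cmod (ell_unit a b P - ell_unit a b Q))\<^sup>2 / 2"
    if "ell_pt 0 a b 0 P" "ell_pt 0 a b 0 Q" for P Q
    using assms that by (intro normal_dot_chord) auto
  have sw: "cmod (x - y) = cmod (y - x)" for x y :: complex by (rule norm_minus_commute)
  have "w12 / cmod (P1 - P2) = w31 / cmod (P3 - P1)" "w23 / cmod (P2 - P3) = w12 / cmod (P1 - P2)"
    using assms(3)
    unfolding periodic3_Re_iff Let_def n[OF on(1,2)] n[OF on(1,3)] n[OF on(2,3)] n[OF on(2,1)] n[OF on(3,1)] n[OF on(3,2)]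
      w12_def w23_def w31_def sw[of P2 P1] sw[of P3 P2] sw[of P1 P3] sw[of "ell_unit a b P1" "ell_unit a b P3"]
      sw[of "ell_unit a b P2" "ell_unit a b P1"]
    by simp_all
  moreover define J where "J = w12 / cmod (P1 - P2) / 2"
  ultimately have "2 * J * cmod (P1 - P2) = w12" "2 * J * cmod (P2 - P3) = w23" "2 * J * cmod (P3 - P1) = w31"
    using sides by (auto simp: field_simps)
  moreover have "J > 0"
  proof -
    have "ell_unit a b P1 \<noteq> ell_unit a b P2"
      using sides(3) assms(1,2) by (auto simp: ell_unit_def complex_eq_iff)
    then show ?thesis using sides by (simp add: J_def w12_def)
  qed
  ultimately show ?thesis using that by (simp add: w12_def w23_def w31_def)
qed

section \<open>The correspondence on the unit circle\<close>

lemma unit_mult_cnj: "cmod u = 1 \<Longrightarrow> u * cnj u = 1"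
  by (simp add: complex_norm_square[symmetric])

text \<open>Squaring removes the side length, and on the unit circle conjugation is inversion, so
  the relation becomes polynomial in \<open>u\<close> and \<open>v\<close> once a factor
  \<open>(u - v)\<^sup>2\<close> is cancelled.\<close>

lemma chord_correspondence:
  assumes "a > 0" "b > 0" and on: "ell_pt 0 a b 0 P" "ell_pt 0 a b 0 Q" and "P \<noteq> Q"
  defines "u \<equiv> ell_unit a b P" and "v \<equiv> ell_unit a b Q"
  assumes J: "2 * J * cmod (P - Q) = (cmod (u - v))\<^sup>2"
  shows "of_real (J\<^sup>2) * (of_real (a\<^sup>2) * (u * v - 1)\<^sup>2 - of_real (b\<^sup>2) * (u * v + 1)\<^sup>2) = (u - v)\<^sup>2"
proof -
  have "u \<noteq> v" using assms by (auto simp: u_def v_def ell_unit_def complex_eq_iff)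
  have 1: "u * cnj u = 1" "v * cnj v = 1"
    using on unit_mult_cnj by (simp_all add: u_def v_def cmod_ell_unit)
  define x y where "x = Re (u - v)" and "y = Im (u - v)"
  define D E where "D = u - v" and "E = cnj u - cnj v"
  have PQ: "(cmod (P - Q))\<^sup>2 = a\<^sup>2 * x\<^sup>2 + b\<^sup>2 * y\<^sup>2"
  proof -
    have "Re (P - Q) = a * x" "Im (P - Q) = b * y"
      using assms(1,2) by (simp_all add: x_def y_def u_def v_def ell_unit_def field_simps)
    then show ?thesis unfolding cmod_power2 by (simp only: power_mult_distrib)
  qed
  have "4 * J\<^sup>2 * (cmod (P - Q))\<^sup>2 = ((cmod (u - v))\<^sup>2)\<^sup>2"
    unfolding J[symmetric] by (simp add: power_mult_distrib)
  then have "4 * J\<^sup>2 * (a\<^sup>2 * x\<^sup>2 + b\<^sup>2 * y\<^sup>2) = (x\<^sup>2 + y\<^sup>2)\<^sup>2"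
    unfolding PQ by (simp add: cmod_power2 x_def y_def)
  then have "complex_of_real (4 * J\<^sup>2 * (a\<^sup>2 * x\<^sup>2 + b\<^sup>2 * y\<^sup>2)) = of_real ((x\<^sup>2 + y\<^sup>2)\<^sup>2)" by simp
  then have r: "4 * of_real (J\<^sup>2) * (of_real (a\<^sup>2) * (of_real x)\<^sup>2 + of_real (b\<^sup>2) * (of_real y)\<^sup>2)
    = ((complex_of_real x)\<^sup>2 + (of_real y)\<^sup>2)\<^sup>2" by simp
  have DE: "D = of_real x + \<i> * of_real y" "E = of_real x - \<i> * of_real y"
    by (simp_all add: D_def E_def x_def y_def complex_eq_iff)
  have "4 * (of_real x)\<^sup>2 = (D + E)\<^sup>2" "4 * (of_real y)\<^sup>2 = - (D - E)\<^sup>2"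
    "(of_real x)\<^sup>2 + (of_real y)\<^sup>2 = D * E"
    unfolding DE by (simp_all add: power2_eq_square algebra_simps)
  with r have e: "of_real (J\<^sup>2) * (of_real (a\<^sup>2) * (D + E)\<^sup>2 - of_real (b\<^sup>2) * (D - E)\<^sup>2) = (D * E)\<^sup>2"
    by algebra
  \<comment> \<open>The difference of inverses is minus the difference divided by the product; this
    eliminates the conjugates.\<close>
  have q: "u * v * E = - D"
  proof -
    have "u * v * E = v * (u * cnj u) - u * (v * cnj v)" by (simp add: E_def algebra_simps)
    then show ?thesis by (simp add: 1 D_def)
  qed
  have "D\<^sup>2 * (of_real (J\<^sup>2) * (of_real (a\<^sup>2) * (u * v - 1)\<^sup>2 - of_real (b\<^sup>2) * (u * v + 1)\<^sup>2)) = D\<^sup>2 * D\<^sup>2"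
  proof -
    have 1: "(D * (u * v - 1)) = u * v * (D + E)" "(D * (u * v + 1)) = u * v * (D - E)"
      using q by algebra+
    have "D\<^sup>2 * (of_real (J\<^sup>2) * (of_real (a\<^sup>2) * (u * v - 1)\<^sup>2 - of_real (b\<^sup>2) * (u * v + 1)\<^sup>2))
      = of_real (J\<^sup>2) * (of_real (a\<^sup>2) * (D * (u * v - 1))\<^sup>2 - of_real (b\<^sup>2) * (D * (u * v + 1))\<^sup>2)"
      by algebra
    also have "\<dots> = (u * v)\<^sup>2 * (of_real (J\<^sup>2) * (of_real (a\<^sup>2) * (D + E)\<^sup>2 - of_real (b\<^sup>2) * (D - E)\<^sup>2))"
      unfolding 1 by algebra
    also have "\<dots> = (D * (u * v * E))\<^sup>2" unfolding e by algebra
    also have "\<dots> = D\<^sup>2 * D\<^sup>2" unfolding q by (simp add: power_mult_distrib)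
    finally show ?thesis .
  qed
  moreover have "D\<^sup>2 \<noteq> 0" using \<open>u \<noteq> v\<close> by (simp add: D_def)
  ultimately show ?thesis unfolding D_def by (metis mult_left_cancel)
qed

text \<open>For a fixed vertex the other two are distinct roots of one quadratic. Subtracting two
  relations and dividing by the difference of the roots lowers the degree; doing so again with the
  results at \<open>u\<close> and \<open>v\<close> gives the first claim.\<close>

lemma correspondence_triple:
  fixes u v w h g :: "'a :: field_char_0"
  assumes dist: "u \<noteq> v" "v \<noteq> w" "w \<noteq> u"
    and uv: "h * ((u * v)\<^sup>2 + 1) - 2 * g * (u * v) = (u - v)\<^sup>2"
    and vw: "h * ((v * w)\<^sup>2 + 1) - 2 * g * (v * w) = (v - w)\<^sup>2"
    and wu: "h * ((w * u)\<^sup>2 + 1) - 2 * g * (w * u) = (w - u)\<^sup>2"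
  shows "h * (u * v + v * w + w * u) = 2 * g - 3" and "u + v + w = - h * (u * v * w)"
proof -
  have "(v - w) * (h * u\<^sup>2 * (v + w) - 2 * g * u) = (v - w) * (v + w - 2 * u)"
    using uv wu by algebra
  then have 1: "h * u\<^sup>2 * (v + w) - 2 * g * u = v + w - 2 * u" using dist by simp
  have "(w - u) * (h * v\<^sup>2 * (w + u) - 2 * g * v) = (w - u) * (w + u - 2 * v)"
    using uv vw by algebra
  then have 2: "h * v\<^sup>2 * (w + u) - 2 * g * v = w + u - 2 * v" using dist by simp
  have "(u - v) * (h * (u * v + v * w + w * u)) = (u - v) * (2 * g - 3)"
    using 1 2 by algebra
  then show 3: "h * (u * v + v * w + w * u) = 2 * g - 3" using dist by simp
  show "u + v + w = - h * (u * v * w)"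
    using 1 3 by algebra
qed

text \<open>The correspondence gives two relations between the elementary symmetric functions, and
  conjugating one of them gives a third. Together they determine an equation for \<open>J\<close> in
  \<open>a\<close> and \<open>b\<close> alone.\<close>

lemma periodic3_invariants:
  assumes ab: "a > 0" "b > 0" and per: "periodic3 0 a b 0 P1 P2 P3"
  defines "u1 \<equiv> ell_unit a b P1" and "u2 \<equiv> ell_unit a b P2" and "u3 \<equiv> ell_unit a b P3"
  obtains J where "J > 0"
    "2 * J * cmod (P1 - P2) = (cmod (u1 - u2))\<^sup>2"
    "2 * J * cmod (P2 - P3) = (cmod (u2 - u3))\<^sup>2"
    "2 * J * cmod (P3 - P1) = (cmod (u3 - u1))\<^sup>2"
    "u1 * u2 + u2 * u3 + u3 * u1 = - of_real (J\<^sup>2 * (a\<^sup>2 - b\<^sup>2))"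
    "u1 + u2 + u3 = - of_real (J\<^sup>2 * (a\<^sup>2 - b\<^sup>2)) * (u1 * u2 * u3)"
    "(J\<^sup>2 * (a\<^sup>2 - b\<^sup>2))\<^sup>2 + 2 * (J\<^sup>2 * (a\<^sup>2 + b\<^sup>2)) = 3"
proof -
  obtain J where J: "J > 0"
    "2 * J * cmod (P1 - P2) = (cmod (u1 - u2))\<^sup>2"
    "2 * J * cmod (P2 - P3) = (cmod (u2 - u3))\<^sup>2"
    "2 * J * cmod (P3 - P1) = (cmod (u3 - u1))\<^sup>2"
    using periodic3_joachimsthal[OF ab per] unfolding u1_def u2_def u3_def by blast
  have nd: "\<not> parallel (P2 - P1) (P3 - P1)"
    and on: "ell_pt 0 a b 0 P1" "ell_pt 0 a b 0 P2" "ell_pt 0 a b 0 P3"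
    using per by (simp_all add: periodic3_def)
  have neq: "P1 \<noteq> P2" "P2 \<noteq> P3" "P3 \<noteq> P1" using triangle_sides(1-3)[OF nd] by auto
  then have dist: "u1 \<noteq> u2" "u2 \<noteq> u3" "u3 \<noteq> u1"
    using J by auto
  define h g where "h = J\<^sup>2 * (a\<^sup>2 - b\<^sup>2)" and "g = J\<^sup>2 * (a\<^sup>2 + b\<^sup>2)"
  have rel: "complex_of_real h * ((ell_unit a b P * ell_unit a b Q)\<^sup>2 + 1) - 2 * of_real g * (ell_unit a b P * ell_unit a b Q)
      = (ell_unit a b P - ell_unit a b Q)\<^sup>2"
    if "ell_pt 0 a b 0 P" "ell_pt 0 a b 0 Q" "P \<noteq> Q"
      "2 * J * cmod (P - Q) = (cmod (ell_unit a b P - ell_unit a b Q))\<^sup>2" for P Q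
    using chord_correspondence[OF ab that]
    by (simp add: h_def g_def power2_eq_square algebra_simps)
  note tr = correspondence_triple[OF dist, of "of_real h" "of_real g"]
  have e2: "of_real h * (u1 * u2 + u2 * u3 + u3 * u1) = 2 * of_real g - 3"
    and e1: "u1 + u2 + u3 = - of_real h * (u1 * u2 * u3)"
    using tr rel[OF on(1,2) neq(1)] rel[OF on(2,3) neq(2)] rel[OF on(3,1) neq(3)] J
    unfolding u1_def u2_def u3_def by blast+
  have c: "u1 * cnj u1 = 1" "u2 * cnj u2 = 1" "u3 * cnj u3 = 1"
    using on unit_mult_cnj by (simp_all add: u1_def u2_def u3_def cmod_ell_unit)
  \<comment> \<open>Multiplied by \<open>u1 * u2 * u3\<close>, the conjugate sum turns into the
    second elementary symmetric function.\<close>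
  have "cnj u1 + cnj u2 + cnj u3 = - of_real h * (cnj u1 * cnj u2 * cnj u3)"
    using arg_cong[OF e1, of cnj] by simp
  then have e2': "u1 * u2 + u2 * u3 + u3 * u1 = - of_real h"
    using c by algebra
  have "complex_of_real (h\<^sup>2 + 2 * g) = of_real 3"
    using e2 unfolding e2' by (simp add: power2_eq_square algebra_simps)
  then have "h\<^sup>2 + 2 * g = 3" by (simp only: of_real_eq_iff)
  with e1 e2' J that show ?thesis by (simp add: h_def g_def)
qed

section \<open>Focus-inversive triangles\<close>

text \<open>The left side is Heron's product for sides that are square roots of the
  \<open>n1\<close>, \<open>n2\<close>, \<open>n3\<close>. When \<open>a\<close> is \<open>c\<close>
  or \<open>- c\<close> the quadratic factors are \<open>c\<close> times squares and suitably signed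
  roots add up to zero, which explains the factor \<open>a\<^sup>2 - c\<^sup>2\<close>.\<close>

lemma weighted_chords_discriminant:
  fixes u v w a c :: "'a :: idom"
  defines "n1 \<equiv> (v - w)\<^sup>2 * (c * u\<^sup>2 + 2 * a * u + c)"
    and "n2 \<equiv> (w - u)\<^sup>2 * (c * v\<^sup>2 + 2 * a * v + c)"
    and "n3 \<equiv> (u - v)\<^sup>2 * (c * w\<^sup>2 + 2 * a * w + c)"
  shows "4 * (n1 * n2 + n2 * n3 + n3 * n1) - (n1 + n2 + n3)\<^sup>2
    = - 4 * (a\<^sup>2 - c\<^sup>2) * ((u - v)\<^sup>2 * (v - w)\<^sup>2 * (w - u)\<^sup>2)"
  unfolding n1_def n2_def n3_def by algebra

text \<open>Written in elementary symmetric functions, the sum and, after \<open>rel\<close>, also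
  \<open>h\<close> times the product are multiples of the same expression
  \<open>c * h * (1 + l\<^sup>2) + a * (h - 3) * l\<close>.\<close>

lemma weighted_chords_sum:
  fixes u v w a c h :: "'a :: idom"
  assumes e1: "u + v + w = - h * (u * v * w)" and e2: "u * v + v * w + w * u = - h"
    and rel: "4 * h * a\<^sup>2 = c\<^sup>2 * ((3 - h) * (1 + h))"
  defines "q \<equiv> \<lambda>t. c * t\<^sup>2 + 2 * a * t + c"
  shows "(1 - h\<^sup>2) * c\<^sup>2 * ((v - w)\<^sup>2 * q u + (w - u)\<^sup>2 * q v + (u - v)\<^sup>2 * q w)
    = - h * (h + 3) * (q u * q v * q w)"
proof -
  define l where "l = u * v * w"
  have "(v - w)\<^sup>2 * q u + (w - u)\<^sup>2 * q v + (u - v)\<^sup>2 * q w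
    = c * (2 * (u * v + v * w + w * u)\<^sup>2 - 6 * (u + v + w) * (u * v * w)
        + 2 * (u + v + w)\<^sup>2 - 6 * (u * v + v * w + w * u))
      + a * (2 * (u + v + w) * (u * v + v * w + w * u) - 18 * (u * v * w))"
    unfolding q_def by algebra
  also have "\<dots> = 2 * (h + 3) * (c * h * (1 + l\<^sup>2) + a * (h - 3) * l)"
    unfolding e1 e2 l_def[symmetric] by algebra
  finally have s: "(v - w)\<^sup>2 * q u + (w - u)\<^sup>2 * q v + (u - v)\<^sup>2 * q w
    = 2 * (h + 3) * (c * h * (1 + l\<^sup>2) + a * (h - 3) * l)" .
  have "q u * q v * q w = c ^ 3 * ((u * v * w)\<^sup>2 + (u * v + v * w + w * u)\<^sup>2 - 2 * (u + v + w) * (u * v * w)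
        + (u + v + w)\<^sup>2 - 2 * (u * v + v * w + w * u) + 1)
      + a * c\<^sup>2 * (2 * (u * v + v * w + w * u) * (u * v * w) + 2 * (u + v + w) * (u * v + v * w + w * u)
        - 6 * (u * v * w) + 2 * (u + v + w))
      + a\<^sup>2 * c * (4 * (u + v + w) * (u * v * w) + 4 * (u * v + v * w + w * u)) + 8 * a ^ 3 * (u * v * w)"
    unfolding q_def by algebra
  also have "\<dots> = c ^ 3 * (1 + h)\<^sup>2 * (1 + l\<^sup>2) + a * c\<^sup>2 * l * (2 * h\<^sup>2 - 4 * h - 6)
      - 4 * h * a\<^sup>2 * c * (1 + l\<^sup>2) + 8 * a ^ 3 * l"
    unfolding e1 e2 l_def[symmetric] by algebra
  finally have p: "q u * q v * q w = c ^ 3 * (1 + h)\<^sup>2 * (1 + l\<^sup>2) + a * c\<^sup>2 * l * (2 * h\<^sup>2 - 4 * h - 6)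
      - 4 * h * a\<^sup>2 * c * (1 + l\<^sup>2) + 8 * a ^ 3 * l" .
  have "h * (q u * q v * q w) = - 2 * (1 - h\<^sup>2) * c\<^sup>2 * (c * h * (1 + l\<^sup>2) + a * (h - 3) * l)"
    unfolding p using rel by algebra
  then show ?thesis unfolding s by algebra
qed

text \<open>Real form of the two preceding identities. Here \<open>d\<close> is the focal distance,
  and \<open>m1\<close>, \<open>m2\<close>, \<open>m3\<close> will be the sides of the
  focus-inversive triangle up to a common factor. Powers of the unimodular product \<open>l\<close>
  convert the polynomial weights into these real ones and cancel.\<close>

lemma focal_weights:
  fixes u v w :: complex and a c :: real
  assumes unit: "cmod u = 1" "cmod v = 1" "cmod w = 1"
  defines "d \<equiv> \<lambda>t. a + c * Re t"
  defines "m1 \<equiv> (cmod (v - w))\<^sup>2 * d u" and "m2 \<equiv> (cmod (w - u))\<^sup>2 * d v"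
    and "m3 \<equiv> (cmod (u - v))\<^sup>2 * d w"
  shows "4 * (m1 * m2 + m2 * m3 + m3 * m1) - (m1 + m2 + m3)\<^sup>2
      = (a\<^sup>2 - c\<^sup>2) * ((cmod (u - v))\<^sup>2 * (cmod (v - w))\<^sup>2 * (cmod (w - u))\<^sup>2)"
    and "u + v + w = - of_real h * (u * v * w) \<Longrightarrow> u * v + v * w + w * u = - of_real h \<Longrightarrow>
      4 * h * a\<^sup>2 = c\<^sup>2 * ((3 - h) * (1 + h)) \<Longrightarrow>
      (1 - h\<^sup>2) * c\<^sup>2 * (m1 + m2 + m3) = 4 * h * (h + 3) * (d u * d v * d w)"
proof -
  define a' c' where "a' = complex_of_real a" and "c' = complex_of_real c"
  define q where "q = (\<lambda>t. c' * t\<^sup>2 + 2 * a' * t + c')"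
  define D where "D = (\<lambda>t. complex_of_real (d t))"
  define l where "l = u * v * w"
  have chord: "x * y * of_real ((cmod (x - y))\<^sup>2) = - ((x - y)\<^sup>2)" if "cmod x = 1" "cmod y = 1" for x y
  proof -
    have "complex_of_real ((cmod (x - y))\<^sup>2) = (x - y) * (cnj x - cnj y)"
      by (simp only: complex_norm_square) simp
    then show ?thesis using unit_mult_cnj[OF that(1)] unit_mult_cnj[OF that(2)] by algebra
  qed
  \<comment> \<open>On the unit circle \<open>2 * Re t\<close> is \<open>t\<close> plus its
    inverse.\<close>
  have D: "q t = 2 * D t * t" if "cmod t = 1" for t
  proof -
    have "2 * complex_of_real (Re t) = t + cnj t" by (simp add: complex_add_cnj)
    moreover have "D t = a' + c' * of_real (Re t)" by (simp add: D_def d_def a'_def c'_def)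
    ultimately show ?thesis using unit_mult_cnj[OF that] unfolding q_def by algebra
  qed
  define W1 W2 W3 where "W1 = complex_of_real ((cmod (v - w))\<^sup>2)" and "W2 = complex_of_real ((cmod (w - u))\<^sup>2)"
    and "W3 = complex_of_real ((cmod (u - v))\<^sup>2)"
  have ch: "v * w * W1 = - ((v - w)\<^sup>2)" "w * u * W2 = - ((w - u)\<^sup>2)" "u * v * W3 = - ((u - v)\<^sup>2)"
    using chord unit by (simp_all only: W1_def W2_def W3_def)
  define M1 M2 M3 where "M1 = W1 * D u" and "M2 = W2 * D v" and "M3 = W3 * D w"
  have M: "of_real m1 = M1" "of_real m2 = M2" "of_real m3 = M3"
    by (simp_all only: M1_def M2_def M3_def m1_def m2_def m3_def W1_def W2_def W3_def D_def of_real_mult)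
  have n: "(v - w)\<^sup>2 * q u = - 2 * l * M1" "(w - u)\<^sup>2 * q v = - 2 * l * M2" "(u - v)\<^sup>2 * q w = - 2 * l * M3"
  proof -
    have "(v - w)\<^sup>2 = - (v * w * W1)" "(w - u)\<^sup>2 = - (w * u * W2)" "(u - v)\<^sup>2 = - (u * v * W3)"
      by (simp_all add: ch)
    then show "(v - w)\<^sup>2 * q u = - 2 * l * M1" "(w - u)\<^sup>2 * q v = - 2 * l * M2" "(u - v)\<^sup>2 * q w = - 2 * l * M3"
      by (simp_all add: D unit l_def M1_def M2_def M3_def mult_ac)
  qed
  have l0: "l \<noteq> 0" using unit by (auto simp: l_def)
  have disc: "(u - v)\<^sup>2 * (v - w)\<^sup>2 * (w - u)\<^sup>2 = - (l\<^sup>2) * (W3 * W1 * W2)"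
  proof -
    have "(u - v)\<^sup>2 * (v - w)\<^sup>2 * (w - u)\<^sup>2 = - (- ((u - v)\<^sup>2) * - ((v - w)\<^sup>2) * - ((w - u)\<^sup>2))"
      by simp
    also have "\<dots> = - (l\<^sup>2) * (W3 * W1 * W2)"
      unfolding ch[symmetric] l_def by (simp add: power2_eq_square mult_ac)
    finally show ?thesis .
  qed
  have "4 * (((v - w)\<^sup>2 * q u) * ((w - u)\<^sup>2 * q v) + ((w - u)\<^sup>2 * q v) * ((u - v)\<^sup>2 * q w)
      + ((u - v)\<^sup>2 * q w) * ((v - w)\<^sup>2 * q u)) - ((v - w)\<^sup>2 * q u + (w - u)\<^sup>2 * q v + (u - v)\<^sup>2 * q w)\<^sup>2
    = - 4 * (a'\<^sup>2 - c'\<^sup>2) * ((u - v)\<^sup>2 * (v - w)\<^sup>2 * (w - u)\<^sup>2)"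
    unfolding q_def by (rule weighted_chords_discriminant)
  then have "4 * l\<^sup>2 * (4 * (M1 * M2 + M2 * M3 + M3 * M1) - (M1 + M2 + M3)\<^sup>2)
    = 4 * l\<^sup>2 * ((a'\<^sup>2 - c'\<^sup>2) * (W3 * W1 * W2))"
    unfolding n disc by (simp add: power2_eq_square algebra_simps)
  then have "4 * (M1 * M2 + M2 * M3 + M3 * M1) - (M1 + M2 + M3)\<^sup>2 = (a'\<^sup>2 - c'\<^sup>2) * (W3 * W1 * W2)"
    using l0 by simp
  then have "complex_of_real (4 * (m1 * m2 + m2 * m3 + m3 * m1) - (m1 + m2 + m3)\<^sup>2)
      = of_real ((a\<^sup>2 - c\<^sup>2) * ((cmod (u - v))\<^sup>2 * (cmod (v - w))\<^sup>2 * (cmod (w - u))\<^sup>2))"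
    unfolding M[symmetric] W1_def W2_def W3_def a'_def c'_def by simp
  then show "4 * (m1 * m2 + m2 * m3 + m3 * m1) - (m1 + m2 + m3)\<^sup>2
      = (a\<^sup>2 - c\<^sup>2) * ((cmod (u - v))\<^sup>2 * (cmod (v - w))\<^sup>2 * (cmod (w - u))\<^sup>2)"
    by (simp only: of_real_eq_iff)
  define h' where "h' = complex_of_real h"
  assume e: "u + v + w = - of_real h * (u * v * w)" "u * v + v * w + w * u = - of_real h"
    and rel: "4 * h * a\<^sup>2 = c\<^sup>2 * ((3 - h) * (1 + h))"
  have "complex_of_real (4 * h * a\<^sup>2) = of_real (c\<^sup>2 * ((3 - h) * (1 + h)))" using rel by simp
  then have rel': "4 * h' * a'\<^sup>2 = c'\<^sup>2 * ((3 - h') * (1 + h'))" by (simp add: h'_def a'_def c'_def)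
  have "(1 - h'\<^sup>2) * c'\<^sup>2 * ((v - w)\<^sup>2 * q u + (w - u)\<^sup>2 * q v + (u - v)\<^sup>2 * q w) = - h' * (h' + 3) * (q u * q v * q w)"
    unfolding q_def by (rule weighted_chords_sum[OF e[folded h'_def] rel'])
  note sum = this
  have prod: "q u * q v * q w = 8 * l * (D u * D v * D w)"
    by (simp add: D unit l_def mult_ac)
  have eq: "2 * l * ((1 - h'\<^sup>2) * c'\<^sup>2 * (M1 + M2 + M3)) = 2 * l * (4 * h' * (h' + 3) * (D u * D v * D w))"
    using sum unfolding n prod by (simp add: algebra_simps)
  have "2 * l \<noteq> 0" using l0 by simp
  from mult_left_cancel[OF this, THEN iffD1, OF eq]
  have "(1 - h'\<^sup>2) * c'\<^sup>2 * (M1 + M2 + M3) = 4 * h' * (h' + 3) * (D u * D v * D w)" .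
  then have "complex_of_real ((1 - h\<^sup>2) * c\<^sup>2 * (m1 + m2 + m3)) = of_real (4 * h * (h + 3) * (d u * d v * d w))"
    unfolding M[symmetric] D_def c'_def h'_def by simp
  then show "(1 - h\<^sup>2) * c\<^sup>2 * (m1 + m2 + m3) = 4 * h * (h + 3) * (d u * d v * d w)"
    by (simp only: of_real_eq_iff)
qed

text \<open>Since \<open>c\<^sup>2 = a\<^sup>2 - b\<^sup>2\<close>, the squared distance is the
  perfect square of \<open>a + c * x\<close>, and this is positive because \<open>c < a\<close> and
  \<open>x\<close> is at least -1.\<close>

lemma focal_distance:
  assumes "a > b" "b > 0" "ell_pt 0 a b 0 P"
  defines "c \<equiv> sqrt (a\<^sup>2 - b\<^sup>2)"
  shows "cmod (P - of_real (- c)) = a + c * Re (ell_unit a b P)" and "a + c * Re (ell_unit a b P) > 0"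
proof -
  have c2: "c\<^sup>2 = a\<^sup>2 - b\<^sup>2" using assms by (simp add: c_def power_mono)
  have c0: "c > 0" using assms by (simp add: c_def power_strict_mono)
  have "c < a" by (rule power2_less_imp_less) (use assms c2 in simp_all)
  define x y where "x = Re P / a" and "y = Im P / b"
  have xy: "x\<^sup>2 + y\<^sup>2 = 1"
    using assms(3) by (simp add: ell_pt_def power_divide x_def y_def)
  then have "x\<^sup>2 \<le> 1\<^sup>2" using zero_le_power2[of y] unfolding one_power2 by linarith
  then have "\<bar>x\<bar> \<le> 1" using abs_le_square_iff[of x 1] by simp
  then have "c * (- 1) \<le> c * x" using c0 by (intro mult_left_mono) auto
  with \<open>c < a\<close> show pos: "a + c * Re (ell_unit a b P) > 0" by (simp add: ell_unit_def x_def)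
  have P: "Re P = a * x" "Im P = b * y" using assms by (simp_all add: x_def y_def)
  have "(cmod (P - of_real (- c)))\<^sup>2 = (a * x + c)\<^sup>2 + (b * y)\<^sup>2"
    unfolding cmod_power2 by (simp add: P)
  also have "\<dots> = (a + c * x)\<^sup>2" using c2 xy by algebra
  finally show "cmod (P - of_real (- c)) = a + c * Re (ell_unit a b P)"
    unfolding x_def by (simp only: ell_unit_def complex.sel)
      (rule power2_eq_imp_eq, assumption, simp, use pos in \<open>simp add: ell_unit_def\<close>)
qed

lemma focus_inv_dist:
  assumes "P \<noteq> f" "Q \<noteq> f"
  shows "cmod (focus_inv rho f P - focus_inv rho f Q) = rho\<^sup>2 * cmod (P - Q) / (cmod (P - f) * cmod (Q - f))"
proof -
  \<comment> \<open>Inversion is division by the conjugate, so a difference of images is a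
    difference of two reciprocals.\<close>
  have inv: "focus_inv rho f P = f + of_real (rho\<^sup>2) / cnj (P - f)" if "P \<noteq> f" for P
  proof -
    have "complex_of_real ((rho / cmod (P - f))\<^sup>2) = of_real (rho\<^sup>2) / ((P - f) * cnj (P - f))"
      by (simp only: power_divide of_real_divide complex_norm_square)
    then show ?thesis using that by (simp add: focus_inv_def)
  qed
  have "focus_inv rho f P - focus_inv rho f Q = of_real (rho\<^sup>2) * cnj (Q - P) / (cnj (P - f) * cnj (Q - f))"
    unfolding inv[OF assms(1)] inv[OF assms(2)] using assms by (simp add: field_simps)
  then show ?thesis
    by (simp add: norm_mult norm_divide norm_power norm_minus_commute del: complex_cnj_diff)
qed

text \<open>The sides are \<open>k\<close> times the focal weights, so the sum identity gives the
  perimeter and the discriminant identity gives \<open>S\<close>. Both depend on the trajectory only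
  through \<open>J\<close>.\<close>

lemma focus_inversive_triangle:
  fixes a b rho :: real
  assumes ab: "a > b" "b > 0" and rho: "rho > 0" and per: "periodic3 0 a b 0 P1 P2 P3"
  defines "c \<equiv> sqrt (a\<^sup>2 - b\<^sup>2)"
  defines "Q1 \<equiv> focus_inv rho (of_real (- c)) P1" and "Q2 \<equiv> focus_inv rho (of_real (- c)) P2"
    and "Q3 \<equiv> focus_inv rho (of_real (- c)) P3"
  defines "x \<equiv> cmod (Q2 - Q3)" and "y \<equiv> cmod (Q3 - Q1)" and "z \<equiv> cmod (Q1 - Q2)"
  obtains J where "J > 0" and "(J\<^sup>2 * (a\<^sup>2 - b\<^sup>2))\<^sup>2 + 2 * (J\<^sup>2 * (a\<^sup>2 + b\<^sup>2)) = 3"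
    and "\<not> parallel (Q2 - Q1) (Q3 - Q1)"
    and "x + y + z = 2 * rho\<^sup>2 * J * (J\<^sup>2 * c\<^sup>2 + 3) / (1 - (J\<^sup>2 * c\<^sup>2)\<^sup>2)"
    and "(2 * (x * y + y * z + z * x) - (x\<^sup>2 + y\<^sup>2 + z\<^sup>2)) / (x * y * z) = 2 * J * b\<^sup>2 / rho\<^sup>2"
proof -
  define u v w where "u = ell_unit a b P1" and "v = ell_unit a b P2" and "w = ell_unit a b P3"
  have a0: "a > 0" using ab by simp
  obtain J where J: "J > 0"
    "2 * J * cmod (P1 - P2) = (cmod (u - v))\<^sup>2"
    "2 * J * cmod (P2 - P3) = (cmod (v - w))\<^sup>2"
    "2 * J * cmod (P3 - P1) = (cmod (w - u))\<^sup>2"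
    "u * v + v * w + w * u = - of_real (J\<^sup>2 * (a\<^sup>2 - b\<^sup>2))"
    "u + v + w = - of_real (J\<^sup>2 * (a\<^sup>2 - b\<^sup>2)) * (u * v * w)"
    "(J\<^sup>2 * (a\<^sup>2 - b\<^sup>2))\<^sup>2 + 2 * (J\<^sup>2 * (a\<^sup>2 + b\<^sup>2)) = 3"
    using periodic3_invariants[OF a0 ab(2) per] unfolding u_def v_def w_def by blast
  have nd: "\<not> parallel (P2 - P1) (P3 - P1)"
    and on: "ell_pt 0 a b 0 P1" "ell_pt 0 a b 0 P2" "ell_pt 0 a b 0 P3"
    using per by (simp_all add: periodic3_def)
  note sides = triangle_sides(1-3)[OF nd]
  have c2: "c\<^sup>2 = a\<^sup>2 - b\<^sup>2" using ab by (simp add: c_def power_mono)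
  have c0: "c > 0" using ab by (simp add: c_def power_strict_mono)
  define h where "h = J\<^sup>2 * c\<^sup>2"
  have h0: "h > 0" using J(1) c0 by (simp add: h_def)
  have hrel: "h\<^sup>2 * c\<^sup>2 + 2 * h * (a\<^sup>2 + b\<^sup>2) = 3 * c\<^sup>2"
  proof -
    have "h\<^sup>2 * c\<^sup>2 + 2 * h * (a\<^sup>2 + b\<^sup>2) = c\<^sup>2 * ((J\<^sup>2 * c\<^sup>2)\<^sup>2 + 2 * (J\<^sup>2 * (a\<^sup>2 + b\<^sup>2)))"
      unfolding h_def by (simp add: power2_eq_square algebra_simps)
    then show ?thesis using J(7) by (simp add: c2)
  qed
  \<comment> \<open>The quadratic for \<open>h\<close> with \<open>b\<close> or \<open>a\<close>
    eliminated. The first version feeds the sum identity, the second forces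
    \<open>h < 1\<close>.\<close>
  have arel: "4 * h * a\<^sup>2 = c\<^sup>2 * ((3 - h) * (1 + h))"
    and brel: "4 * h * b\<^sup>2 = c\<^sup>2 * ((3 + h) * (1 - h))"
    using hrel c2 by algebra+
  have "4 * h * b\<^sup>2 > 0" using h0 ab by simp
  then have "(3 + h) * (1 - h) > 0" unfolding brel using c0 by (simp add: zero_less_mult_iff)
  then have h1: "h < 1" using h0 by (simp add: zero_less_mult_iff)
  have h2: "1 - h\<^sup>2 > 0" using h0 h1 by (simp add: power_less_one_iff)
  have unit: "cmod u = 1" "cmod v = 1" "cmod w = 1"
    using on by (simp_all add: u_def v_def w_def cmod_ell_unit)
  define d where "d = (\<lambda>t. a + c * Re t)"
  have d: "cmod (P1 - of_real (- c)) = d u" "cmod (P2 - of_real (- c)) = d v" "cmod (P3 - of_real (- c)) = d w"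
    and d0: "d u > 0" "d v > 0" "d w > 0"
    using focal_distance[OF ab] on by (simp_all only: d_def u_def v_def w_def c_def)
  define m1 m2 m3 where "m1 = (cmod (v - w))\<^sup>2 * d u" and "m2 = (cmod (w - u))\<^sup>2 * d v"
    and "m3 = (cmod (u - v))\<^sup>2 * d w"
  define W where "W = (cmod (u - v))\<^sup>2 * (cmod (v - w))\<^sup>2 * (cmod (w - u))\<^sup>2"
  have wpos: "(cmod (u - v))\<^sup>2 > 0" "(cmod (v - w))\<^sup>2 > 0" "(cmod (w - u))\<^sup>2 > 0"
    unfolding J(2-4)[symmetric] using sides J(1) by simp_all
  have W0: "W > 0" using wpos unfolding W_def by (intro mult_pos_pos)
  define D where "D = d u * d v * d w"
  have D0: "D > 0" using d0 by (simp add: D_def)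
  have H: "4 * (m1 * m2 + m2 * m3 + m3 * m1) - (m1 + m2 + m3)\<^sup>2 = b\<^sup>2 * W"
    using focal_weights(1)[OF unit, of a c] c2
    by (simp add: m1_def m2_def m3_def W_def d_def)
  have E: "(1 - h\<^sup>2) * c\<^sup>2 * (m1 + m2 + m3) = 4 * h * (h + 3) * D"
    unfolding m1_def m2_def m3_def D_def d_def
    by (rule focal_weights(2)[OF unit]) (use J(5,6) arel in \<open>simp_all add: h_def c2\<close>)
  define k where "k = rho\<^sup>2 / (2 * J * D)"
  have k0: "k > 0" using rho J(1) D0 by (simp add: k_def)
  have ne: "P1 \<noteq> of_real (- c)" "P2 \<noteq> of_real (- c)" "P3 \<noteq> of_real (- c)"
    using d d0 by auto
  have xyz: "x = k * m1" "y = k * m2" "z = k * m3"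
    unfolding x_def y_def z_def Q1_def Q2_def Q3_def focus_inv_dist[OF ne(2,3)] focus_inv_dist[OF ne(3,1)]
      focus_inv_dist[OF ne(1,2)] d k_def m1_def m2_def m3_def D_def J(2-4)[symmetric]
    using J(1) d0 by (simp_all add: field_simps)
  have "x + y + z = k * (m1 + m2 + m3)" unfolding xyz by (simp add: algebra_simps)
  also have "m1 + m2 + m3 = 4 * h * (h + 3) * D / ((1 - h\<^sup>2) * c\<^sup>2)"
    using E h2 c0 by (simp add: field_simps)
  also have "k * \<dots> = 2 * rho\<^sup>2 * J * (h + 3) / (1 - h\<^sup>2)"
  proof -
    have "k * (4 * h * (h + 3) * D / ((1 - h\<^sup>2) * c\<^sup>2)) = (k * (2 * J * D)) * (2 * J * (h + 3) / (1 - h\<^sup>2))"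
      using J(1) c0 h2 by (simp add: h_def power2_eq_square)
    also have "k * (2 * J * D) = rho\<^sup>2" using J(1) D0 by (simp add: k_def)
    finally show ?thesis by (simp add: mult_ac)
  qed
  finally have L: "x + y + z = 2 * rho\<^sup>2 * J * (h + 3) / (1 - h\<^sup>2)" .
  have xyz_prod: "x * y * z = k ^ 3 * (W * D)"
    unfolding xyz m1_def m2_def m3_def W_def D_def by (simp add: power3_eq_cube mult_ac)
  have xyz0: "x * y * z > 0" unfolding xyz_prod using k0 W0 D0 by simp
  have s: "2 * (x * y + y * z + z * x) - (x\<^sup>2 + y\<^sup>2 + z\<^sup>2) = k\<^sup>2 * (b\<^sup>2 * W)"
    unfolding xyz H[symmetric] by (simp add: power2_eq_square algebra_simps)
  have S: "(2 * (x * y + y * z + z * x) - (x\<^sup>2 + y\<^sup>2 + z\<^sup>2)) / (x * y * z) = 2 * J * b\<^sup>2 / rho\<^sup>2"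
  proof -
    have "k\<^sup>2 * (b\<^sup>2 * W) / (k ^ 3 * (W * D)) = b\<^sup>2 / (k * D)"
      using k0 W0 by (simp add: power2_eq_square power3_eq_cube)
    also have "k * D = rho\<^sup>2 / (2 * J)" using D0 by (simp add: k_def)
    finally show ?thesis unfolding s xyz_prod by simp
  qed
  \<comment> \<open>The product of perimeter and \<open>S\<close> exceeds 8 by
    \<open>(1 - h)\<^sup>2 / (1 + h)\<close>; through Heron's formula this excess is what makes the
    inverted triangle nondegenerate.\<close>
  have "(x + y + z) * (2 * J * b\<^sup>2 / rho\<^sup>2) = (h + 3)\<^sup>2 / (1 + h)"
  proof -
    have "(x + y + z) * (2 * J * b\<^sup>2 / rho\<^sup>2) = 4 * J\<^sup>2 * b\<^sup>2 * (h + 3) / (1 - h\<^sup>2)"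
      unfolding L using rho by (simp add: power2_eq_square)
    also have "4 * J\<^sup>2 * b\<^sup>2 = (3 + h) * (1 - h)"
    proof -
      have "c\<^sup>2 * (4 * J\<^sup>2 * b\<^sup>2) = c\<^sup>2 * ((3 + h) * (1 - h))" using brel by (simp add: h_def mult_ac)
      then show ?thesis using c0 by simp
    qed
    also have "1 - h\<^sup>2 = (1 - h) * (1 + h)" by (simp add: power2_eq_square algebra_simps)
    finally show ?thesis using h0 h1 by (simp add: power2_eq_square add.commute)
  qed
  also have "(h + 3)\<^sup>2 / (1 + h) = 8 + (1 - h)\<^sup>2 / (1 + h)"
    using h0 by (simp add: power2_eq_square field_simps)
  also have "\<dots> > 8" using h0 h1 by simp
  finally have LS: "(x + y + z) * (2 * J * b\<^sup>2 / rho\<^sup>2) > 8" .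
  have "(y + z - x) * (z + x - y) * (x + y - z)
    = (x + y + z) * (2 * (x * y + y * z + z * x) - (x\<^sup>2 + y\<^sup>2 + z\<^sup>2)) - 8 * (x * y * z)"
    by (simp add: power2_eq_square algebra_simps)
  also have "2 * (x * y + y * z + z * x) - (x\<^sup>2 + y\<^sup>2 + z\<^sup>2) = (2 * J * b\<^sup>2 / rho\<^sup>2) * (x * y * z)"
    using S xyz0 by (metis nonzero_divide_eq_eq less_irrefl)
  also have "(x + y + z) * ((2 * J * b\<^sup>2 / rho\<^sup>2) * (x * y * z)) - 8 * (x * y * z)
    = ((x + y + z) * (2 * J * b\<^sup>2 / rho\<^sup>2) - 8) * (x * y * z)" by (simp only: left_diff_distrib mult.assoc)
  also have "\<dots> > 0" using LS xyz0 by simp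
  finally have "(y + z - x) * (z + x - y) * (x + y - z) > 0" .
  moreover have "x + y + z > 0"
    unfolding L using rho J(1) h0 h2 by simp
  ultimately have "(x + y + z) * ((y + z - x) * (z + x - y) * (x + y - z)) > 0" by (rule mult_pos_pos[rotated])
  then have nd': "\<not> parallel (Q2 - Q1) (Q3 - Q1)"
    unfolding x_def y_def z_def heron parallel_def by auto
  show ?thesis
    by (rule that[OF J(1,7) nd' L[unfolded h_def] S])
qed

section \<open>Uniqueness of the invariants and conclusion\<close>

lemma joachimsthal_unique:
  fixes J J' p q :: real
  assumes "J > 0" "J' > 0" "q > 0"
    "(J\<^sup>2 * p)\<^sup>2 + 2 * (J\<^sup>2 * q) = 3" "(J'\<^sup>2 * p)\<^sup>2 + 2 * (J'\<^sup>2 * q) = 3"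
  shows "J = J'"
proof -
  \<comment> \<open>The equation is quadratic in the square of \<open>J\<close> and strictly
    increasing for positive arguments; the cofactor of the difference is positive.\<close>
  have "(J\<^sup>2 - J'\<^sup>2) * ((J\<^sup>2 + J'\<^sup>2) * p\<^sup>2 + 2 * q) = 0"
  proof -
    have "(J\<^sup>2 - J'\<^sup>2) * ((J\<^sup>2 + J'\<^sup>2) * p\<^sup>2 + 2 * q)
      = ((J\<^sup>2 * p)\<^sup>2 + 2 * (J\<^sup>2 * q)) - ((J'\<^sup>2 * p)\<^sup>2 + 2 * (J'\<^sup>2 * q))"
      by (simp add: power2_eq_square algebra_simps)
    then show ?thesis using assms(4,5) by simp
  qed
  moreover have "(J\<^sup>2 + J'\<^sup>2) * p\<^sup>2 + 2 * q > 0"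
    using assms(3) by (intro add_nonneg_pos) auto
  ultimately have "J\<^sup>2 = J'\<^sup>2" by simp
  then show ?thesis using assms by (simp add: power2_eq_iff_nonneg)
qed

text \<open>Sum and product determine two numbers up to order. The order stays open because a
  quarter turn of \<open>th\<close> exchanges the semi-axes.\<close>

lemma semi_axes_unique:
  fixes x y x' y' :: real
  assumes "x > 0" "y > 0" "x' > 0" "y' > 0"
    and sum: "1 / x\<^sup>2 + 1 / y\<^sup>2 = 1 / x'\<^sup>2 + 1 / y'\<^sup>2"
    and prod: "(1 / x\<^sup>2) * (1 / y\<^sup>2) = (1 / x'\<^sup>2) * (1 / y'\<^sup>2)"
  shows "{x, y} = {x', y'}"
proof -
  have inj: "r = s" if "1 / r\<^sup>2 = 1 / s\<^sup>2" "r > 0" "s > 0" for r s :: real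
    using that by (simp add: power2_eq_iff_nonneg)
  have "(1 / x\<^sup>2 - 1 / x'\<^sup>2) * (1 / x\<^sup>2 - 1 / y'\<^sup>2) = 0"
    using sum prod by algebra
  then consider "1 / x\<^sup>2 = 1 / x'\<^sup>2" | "1 / x\<^sup>2 = 1 / y'\<^sup>2" by (auto simp del: divide_eq_eq)
  then show ?thesis
  proof cases
    case 1
    then have "1 / y\<^sup>2 = 1 / y'\<^sup>2" using sum by linarith
    with 1 show ?thesis using inj assms(1-4) by metis
  next
    case 2
    then have "1 / y\<^sup>2 = 1 / x'\<^sup>2" using sum by linarith
    with 2 have "x = y'" "y = x'" using inj assms(1-4) by metis+
    then show ?thesis by auto
  qed
qed

theorem mainTheorem5:
  fixes a b rho :: real
  assumes "a > b" and "b > 0" and "rho > 0"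
  defines "f1 \<equiv> complex_of_real (- sqrt (a\<^sup>2 - b\<^sup>2))"
  shows "\<exists>A B. A > 0 \<and> B > 0 \<and>
           (\<forall>P1 P2 P3. periodic3 0 a b 0 P1 P2 P3 \<longrightarrow>
              (let Q1 = focus_inv rho f1 P1; Q2 = focus_inv rho f1 P2; Q3 = focus_inv rho f1 P3;
                   X9 = mittenpunkt Q1 Q2 Q3 in
                 (\<exists>al be th. al > 0 \<and> be > 0 \<and>
                    ell_pt X9 al be th Q1 \<and> ell_pt X9 al be th Q2 \<and> ell_pt X9 al be th Q3) \<and>
                 (\<forall>al be th. al > 0 \<and> be > 0 \<and>
                    ell_pt X9 al be th Q1 \<and> ell_pt X9 al be th Q2 \<and> ell_pt X9 al be th Q3 \<longrightarrow>
                    {al, be} = {A, B} \<and> periodic3 X9 al be th Q1 Q2 Q3)))"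
proof -
  define Q where "Q = focus_inv rho f1"
  define X where "X = (\<lambda>P1 P2 P3. mittenpunkt (Q P1) (Q P2) (Q P3))"
  define circ where "circ = (\<lambda>P1 P2 P3 al be th. ell_pt (X P1 P2 P3) al be th (Q P1) \<and>
    ell_pt (X P1 P2 P3) al be th (Q P2) \<and> ell_pt (X P1 P2 P3) al be th (Q P3))"
  \<comment> \<open>\<open>T\<close> and \<open>D\<close> are the trace and determinant of the form
    of the circumellipse, chosen before the trajectory.\<close>
  have "\<exists>T D. \<forall>P1 P2 P3. periodic3 0 a b 0 P1 P2 P3 \<longrightarrow>
      (\<exists>al be th. al > 0 \<and> be > 0 \<and> circ P1 P2 P3 al be th) \<and>
      (\<forall>al be th. circ P1 P2 P3 al be th \<longrightarrow>
        1 / al\<^sup>2 + 1 / be\<^sup>2 = T \<and> (1 / al\<^sup>2) * (1 / be\<^sup>2) = D \<and>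
        periodic3 (X P1 P2 P3) al be th (Q P1) (Q P2) (Q P3))"
  proof (cases "\<exists>P1 P2 P3. periodic3 0 a b 0 P1 P2 P3")
    case True
    \<comment> \<open>The constant of an arbitrary member; by uniqueness it serves the whole
      family.\<close>
    then obtain J0 where J0: "J0 > 0" "(J0\<^sup>2 * (a\<^sup>2 - b\<^sup>2))\<^sup>2 + 2 * (J0\<^sup>2 * (a\<^sup>2 + b\<^sup>2)) = 3"
      using focus_inversive_triangle[OF assms(1-3)] by metis
    define c where "c = sqrt (a\<^sup>2 - b\<^sup>2)"
    define L S where "L = 2 * rho\<^sup>2 * J0 * (J0\<^sup>2 * c\<^sup>2 + 3) / (1 - (J0\<^sup>2 * c\<^sup>2)\<^sup>2)"
      and "S = 2 * J0 * b\<^sup>2 / rho\<^sup>2"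
    show ?thesis
    proof (intro exI allI impI)
      fix P1 P2 P3 assume per: "periodic3 0 a b 0 P1 P2 P3"
      define x y z where "x = cmod (Q P2 - Q P3)" and "y = cmod (Q P3 - Q P1)" and "z = cmod (Q P1 - Q P2)"
      obtain J where J: "J > 0" "(J\<^sup>2 * (a\<^sup>2 - b\<^sup>2))\<^sup>2 + 2 * (J\<^sup>2 * (a\<^sup>2 + b\<^sup>2)) = 3"
        and nd: "\<not> parallel (Q P2 - Q P1) (Q P3 - Q P1)"
        and L: "x + y + z = 2 * rho\<^sup>2 * J * (J\<^sup>2 * c\<^sup>2 + 3) / (1 - (J\<^sup>2 * c\<^sup>2)\<^sup>2)"
        and S: "(2 * (x * y + y * z + z * x) - (x\<^sup>2 + y\<^sup>2 + z\<^sup>2)) / (x * y * z) = 2 * J * b\<^sup>2 / rho\<^sup>2"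
        using focus_inversive_triangle[OF assms(1-3) per]
        unfolding Q_def f1_def c_def x_def y_def z_def by metis
      have "a\<^sup>2 + b\<^sup>2 > 0" using assms by (simp add: add_pos_pos)
      then have "J = J0" using joachimsthal_unique J J0 by blast
      note LS = L[unfolded this, folded L_def] S[unfolded this, folded S_def]
      note ell = mittenpunkt_circumellipse[OF nd, folded x_def y_def z_def, unfolded LS]
      show "(\<exists>al be th. al > 0 \<and> be > 0 \<and> circ P1 P2 P3 al be th) \<and>
        (\<forall>al be th. circ P1 P2 P3 al be th \<longrightarrow>
          1 / al\<^sup>2 + 1 / be\<^sup>2 = 2 * S * (L * S - 6) / (L * (L * S - 8)) \<and>
          (1 / al\<^sup>2) * (1 / be\<^sup>2) = S ^ 3 / (L * (L * S - 8)) \<and>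
          periodic3 (X P1 P2 P3) al be th (Q P1) (Q P2) (Q P3))"
        unfolding circ_def X_def using ell by blast
    qed
  qed blast
  then obtain T D where TD: "\<And>P1 P2 P3. periodic3 0 a b 0 P1 P2 P3 \<Longrightarrow>
      (\<exists>al be th. al > 0 \<and> be > 0 \<and> circ P1 P2 P3 al be th)"
      "\<And>P1 P2 P3 al be th. periodic3 0 a b 0 P1 P2 P3 \<Longrightarrow> circ P1 P2 P3 al be th \<Longrightarrow>
        1 / al\<^sup>2 + 1 / be\<^sup>2 = T \<and> (1 / al\<^sup>2) * (1 / be\<^sup>2) = D \<and>
        periodic3 (X P1 P2 P3) al be th (Q P1) (Q P2) (Q P3)"
    by metis
  have "\<exists>A B. A > 0 \<and> B > 0 \<and> (\<forall>P1 P2 P3 al be th. periodic3 0 a b 0 P1 P2 P3 \<longrightarrow>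
      al > 0 \<longrightarrow> be > 0 \<longrightarrow> circ P1 P2 P3 al be th \<longrightarrow> {al, be} = {A, B})"
  proof (cases "\<exists>P1 P2 P3. periodic3 0 a b 0 P1 P2 P3")
    case True
    \<comment> \<open>The semi-axes of the circumellipse of one member serve as the invariant
      pair.\<close>
    then obtain A B where AB: "A > 0" "B > 0" "1 / A\<^sup>2 + 1 / B\<^sup>2 = T" "(1 / A\<^sup>2) * (1 / B\<^sup>2) = D"
      using TD by metis
    have "{al, be} = {A, B}" if "periodic3 0 a b 0 P1 P2 P3" "al > 0" "be > 0" "circ P1 P2 P3 al be th"
      for P1 P2 P3 al be th
      using semi_axes_unique[OF that(2,3) AB(1,2)] TD(2)[OF that(1,4)] AB(3,4) by metis
    with AB show ?thesis by blast
  next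
    case False
    \<comment> \<open>Without a trajectory the claim is vacuous, and 1 is a placeholder for both
      axes.\<close>
    then show ?thesis by (intro exI[of _ 1]) auto
  qed
  then obtain A B where "A > 0" "B > 0" and AB: "\<And>P1 P2 P3 al be th. periodic3 0 a b 0 P1 P2 P3 \<Longrightarrow>
      al > 0 \<Longrightarrow> be > 0 \<Longrightarrow> circ P1 P2 P3 al be th \<Longrightarrow> {al, be} = {A, B}" by blast
  show ?thesis
    unfolding Let_def Q_def[symmetric]
  proof (rule exI[of _ A], rule exI[of _ B], intro conjI allI impI, fact, fact, goal_cases)
    case (1 P1 P2 P3)
    then show ?case using TD(1) unfolding circ_def X_def by blast
  next
    case (2 P1 P2 P3 al be th)
    then show ?case using AB unfolding circ_def X_def by blast
  next
    case (3 P1 P2 P3 al be th)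
    then show ?case using TD(2) unfolding circ_def X_def by blast
  qed
qed

end
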